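(* Let $R>0$ be arbitrary, and let $\varepsilon>0$ be fixed and sufficiently small, with $u_\varepsilon$, $\Omega_-$ and the map $\xi=\lambda(z)$ (depending on $m$), with inverse $z(\xi)$, as in the context. Let $$q_\ell(\xi)=e^{\frac{\pi i}{4}}D_{-\frac12}\left(e^{-\frac{3\pi i}{4}}\xi\right)-i\sqrt2\,D_{-\frac12}\left(e^{-\frac{5\pi i}{4}}\xi\right).$$ For each zero $\xi_k^*$ of $q_\ell$ with $|\xi_k^*|<R$ and $z(\xi_k^* )\in\Omega_-\cap u_\varepsilon\cap\mathbb{C}^+$ (for all sufficiently large $m$), there exist an integer $M>0$ and a constant $C>0$ such that if $m\ge M$, there is a zero $z_k=z(\xi_k)$ of $\pi_m$ satisfying $$|\xi_k^*-\xi_k|\le\frac{C}{m^{1/4}}.$$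
   Context: **Polynomials.** For an integer $m\ge 1$ let $$P_m(z)=P_m^{(m+\frac12,-m-\frac12)}(z)=2^{-m}\sum_{k=0}^m\binom{2m+\frac12}{m-k}\binom{-\frac12}{k}(z-1)^k(z+1)^{m-k}$$ (generalized binomial coefficients), which is the Jacobi polynomial $P_m^{(\alpha,\beta)}$ with $\alpha=m+\frac12$, $\beta=-m-\frac12$. Let $\pi_m(z)=P_m(z)/\kappa_m$ with $\kappa_m=2^{-m}\binom{2m}{m}$, so that $\pi_m$ is monic of degree $m$. **Region.** $\mathbb{C}^+$ is the open upper half-plane and $u_\varepsilon=\{z\in\mathbb{C}:|z|<\varepsilon\}$. Let $\Sigma_{-1}=\{z:|1-z^2|=1,\ \mathrm{Re}\,z\le 0\}$, a simple closed curve through the origin encircling $-1$. Let $\Sigma_{1/r}$ be a fixed (independent of $m$) simple closed curve consisting of the segment $[-i\varepsilon,i\varepsilon]$ of the imaginary axis together with a simple differentiable arc in the open left half-plane joining the endpoints of this segment, such that $\Sigma_{-1}\setminus\{0\}$ lies inside $\Sigma_{1/r}$ and this arc stays at a positive distance from $\Sigma_{-1}$. Then $\Omega_-$ is the open region of points inside $\Sigma_{1/r}$ and outside $\Sigma_{-1}$. **Local variable.** For $z\in u_\varepsilon$, $$\xi=\lambda(z)=\sqrt{2m}\,z\,e^{-\pi i/4}\,\tau(z),\qquad \tau(z)=\sqrt{\sum_{k=0}^\infty\frac{z^{2k}}{k+1}},\quad \tau(0)=1,$$ where $\varepsilon$ is small enough that $\tau$ is analytic in $u_\varepsilon$ and $\lambda$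 is biholomorphic from $u_\varepsilon$ onto its image. It satisfies $(1-z^2)^m=e^{-i\xi^2/2}$; $z(\xi)$ denotes the inverse map (both depend on $m$). **Special function.** $D_\nu$ is the standard (Whittaker) parabolic cylinder function: the entire solution of $D_\nu''(\eta)+\left(\nu+\frac12-\frac{\eta^2}{4}\right)D_\nu(\eta)=0$ with $D_\nu(\eta)\sim\eta^\nu e^{-\eta^2/4}$ as $\eta\to\infty$ in $|\arg\eta|<\frac{3\pi}{4}$. *)

theory Defs
  imports "HOL-Complex_Analysis.Complex_Analysis"
begin

definition jacobi_P :: "nat \<Rightarrow> complex \<Rightarrow> complex" where
  "jacobi_P m z = (1 / 2 ^ m) *
     (\<Sum>k = 0..m. ((2 * of_nat m + 1 / 2) gchoose (m - k)) * ((- 1 / 2) gchoose k)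
        * (z - 1) ^ k * (z + 1) ^ (m - k))"

definition kappa :: "nat \<Rightarrow> complex" where
  "kappa m = of_nat ((2 * m) choose m) / 2 ^ m"

definition monic_P :: "nat \<Rightarrow> complex \<Rightarrow> complex" where
  "monic_P m z = jacobi_P m z / kappa m"

definition Sigma_minus1 :: "complex set" where
  "Sigma_minus1 = {z. cmod (1 - z\<^sup>2) = 1 \<and> Re z \<le> 0}"

text \<open>The outer curve is given by its arc \<open>g\<close> in the left half-plane; the
  rest of the curve is the segment of the imaginary axis joining the end points of \<open>g\<close>.\<close>

definition Sigma_outer :: "real \<Rightarrow> (real \<Rightarrow> complex) \<Rightarrow> complex set" where
  "Sigma_outer \<epsilon> g = closed_segment (- \<i> * of_real \<epsilon>) (\<i> * of_real \<epsilon>) \<union> path_image g"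

definition admissible_arc :: "real \<Rightarrow> (real \<Rightarrow> complex) \<Rightarrow> bool" where
  "admissible_arc \<epsilon> g \<longleftrightarrow>
     arc g \<and> g differentiable_on {0..1} \<and>
     pathstart g = \<i> * of_real \<epsilon> \<and> pathfinish g = - \<i> * of_real \<epsilon> \<and>
     (\<forall>t\<in>{0<..<1}. Re (g t) < 0) \<and>
     Sigma_minus1 - {0} \<subseteq> inside (Sigma_outer \<epsilon> g) \<and>
     setdist (path_image g) Sigma_minus1 > 0"

definition Omega_minus :: "real \<Rightarrow> (real \<Rightarrow> complex) \<Rightarrow> complex set" where
  "Omega_minus \<epsilon> g = inside (Sigma_outer \<epsilon> g) \<inter> outside Sigma_minus1"

definition upper_half_plane :: "complex set" where
  "upper_half_plane = {z. Im z > 0}"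

text \<open>The principal root is the right branch near the origin: the series has value 1 there.\<close>

definition tau :: "complex \<Rightarrow> complex" where
  "tau z = csqrt (\<Sum>k. z ^ (2 * k) / (of_nat k + 1))"

definition lam :: "nat \<Rightarrow> complex \<Rightarrow> complex" where
  "lam m z = of_real (sqrt (2 * real m)) * z * exp (- (of_real pi * \<i> / 4)) * tau z"

definition lam_inv :: "real \<Rightarrow> nat \<Rightarrow> complex \<Rightarrow> complex" where
  "lam_inv \<epsilon> m = inv_into (ball 0 \<epsilon>) (lam m)"

text \<open>The second conjunct says that \<open>lam m\<close> is biholomorphic from the disc onto its image.
  For \<open>m = 0\<close> the map vanishes identically.\<close>

definition local_chart :: "real \<Rightarrow> bool" where
  "local_chart \<epsilon> \<longleftrightarrow>
     tau analytic_on ball 0 \<epsilon> \<and>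
     (\<forall>m\<ge>1. lam m holomorphic_on ball 0 \<epsilon> \<and> inj_on (lam m) (ball 0 \<epsilon>) \<and>
        open (lam m ` ball 0 \<epsilon>) \<and> lam_inv \<epsilon> m holomorphic_on (lam m ` ball 0 \<epsilon>))"

text \<open>As usual, the asymptotic relation in the open sector is understood to be uniform in each
  closed subsector. It is not uniform in the whole open sector: as the argument tends to
  \<open>\<plusminus> 3 \<pi> / 4\<close> a second exponential term, with factor \<open>exp (\<eta>\<^sup>2 / 4)\<close>, becomes comparable.\<close>

definition is_parabolic_cylinder :: "complex \<Rightarrow> (complex \<Rightarrow> complex) \<Rightarrow> bool" where
  "is_parabolic_cylinder \<nu> D \<longleftrightarrow>
     D holomorphic_on UNIV \<and>
     (\<forall>\<eta>. deriv (deriv D) \<eta> + (\<nu> + 1 / 2 - \<eta>\<^sup>2 / 4) * D \<eta> = 0) \<and>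
     (\<forall>\<delta>>0. ((\<lambda>\<eta>. D \<eta> / (\<eta> powr \<nu> * exp (- (\<eta>\<^sup>2 / 4)))) \<longlongrightarrow> 1)
        (inf at_infinity (principal {\<eta>. \<bar>Arg \<eta>\<bar> \<le> 3 * pi / 4 - \<delta>})))"

definition parabolic_cylinder :: "complex \<Rightarrow> complex \<Rightarrow> complex" where
  "parabolic_cylinder \<nu> = (THE D. is_parabolic_cylinder \<nu> D)"

definition q_ell :: "complex \<Rightarrow> complex" where
  "q_ell \<xi> =
     exp (of_real pi * \<i> / 4) *
       parabolic_cylinder (- 1 / 2) (exp (- (3 * of_real pi * \<i> / 4)) * \<xi>)
     - \<i> * of_real (sqrt 2) *
       parabolic_cylinder (- 1 / 2) (exp (- (5 * of_real pi * \<i> / 4)) * \<xi>)"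

end

theory Submission
  imports Defs "HOL-Probability.Distributions" "HOL-Real_Asymp.Real_Asymp"
begin

text \<open>
The Jacobi polynomials and the parabolic cylinder function are given by two integrals of the same
shape, and the theorem expresses the convergence of the first to the second. Write
\<open>E(\<eta>) = \<integral> exp (- s ^ 4 / 2 - \<eta> * s ^ 2) ds\<close>, integrated over the positive half-line.

On the one hand, \<open>D(\<eta>) = 2 / sqrt pi * exp (- \<eta> ^ 2 / 4) * E(\<eta>)\<close> is the parabolic cylinder function of
index \<open>- 1 / 2\<close>. Differentiation under the integral yields Weber's equation, and turning the ray of
integration yields the asymptotics in every closed subsector of \<open>\<bar>Arg \<eta>\<bar> < 3 * pi / 4\<close>
(\<open>quartic_laplace_asymptotic\<close>). No other entire solution has this behaviour
(\<open>parabolic_cylinder_eq_weber_D\<close>). The equation is invariant under \<open>\<eta> \<mapsto> \<i> * \<eta>\<close>; comparing initial values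
at \<open>0\<close> gives the connection formula, which collapses \<open>q_ell \<xi>\<close> to a constant of modulus 1 times \<open>D (cis (pi / 4) * \<xi>)\<close>
(\<open>q_ell_eq_weber_D\<close>).

On the other hand, the coefficients of the Jacobi polynomial are Beta integrals, which sum up to
\<open>P_m(z) = c_m * (1 + z) ^ m * \<integral> ((1 - s ^ 2) * (1 + (1 - z) / (1 + z) * s ^ 2)) ^ m ds\<close> over \<open>{0..1}\<close>
with \<open>c_m \<noteq> 0\<close> (\<open>jacobi_P_eq_integral\<close>). Put \<open>N = (2 * m) powr (1 / 4)\<close>, \<open>s = x / N\<close> and \<open>z = \<zeta> / N ^ 2\<close>.
Then the base of the power is \<open>1 - (\<zeta> * x ^ 2 + x ^ 4 / 2) / m\<close> up to smaller terms, so \<open>N\<close> times the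
integral tends to \<open>E(\<zeta>)\<close>, and the error is \<open>O(1 / sqrt m)\<close> uniformly for bounded \<open>\<zeta>\<close>
(\<open>jacobi_integral_close\<close>).

Zeros of a nontrivial solution of a second-order linear equation are simple. Hence \<open>\<bar>E\<bar>\<close> grows linearly
away from each zero, and by the minimum principle the approximating function has a zero at distance
\<open>O(1 / sqrt m)\<close> (\<open>jacobi_zero_near_weber_zero\<close>). The coordinate \<open>lam m z\<close> equals
\<open>cis (- (pi / 4)) * sqrt (2 * m) * z\<close> up to the factor \<open>tau z = 1 + O(z)\<close>, which is \<open>1 + O(1 / sqrt m)\<close> at
the points in question. So the zeros in the local variable are again \<open>O(1 / sqrt m)\<close> apart, and this is at
most a constant times \<open>m powr (- 1 / 4)\<close>.
\<close>

section \<open>Improper integrals of exponentially decaying functions\<close>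

text \<open>One class of integrands on the half-line that is closed under the linear operations below and
makes every improper integral in the argument converge. The rate \<open>exp (- s)\<close> is a convenient
common majorant; the functions in question decay like a Gaussian or like \<open>exp (- c * s ^ 4)\<close>.\<close>

definition exp_decay :: "(real \<Rightarrow> 'a::real_normed_vector) \<Rightarrow> bool" where
  "exp_decay f \<longleftrightarrow> continuous_on {0..} f \<and> (\<exists>C. \<forall>s\<ge>0. norm (f s) \<le> C * exp (- s))"

lemma exp_decayI:
  assumes "continuous_on {0..} f" "exp_decay g" "\<And>s. s \<ge> 0 \<Longrightarrow> norm (f s) \<le> norm (g s)"
  shows "exp_decay f"
  using assms unfolding exp_decay_def by (meson order_trans)

lemma exp_decay_add:
  assumes "exp_decay f" "exp_decay g"
  shows "exp_decay (\<lambda>s. f s + g s)"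
proof -
  from assms obtain A B where "\<And>s. s \<ge> 0 \<Longrightarrow> norm (f s) \<le> A * exp (- s)" "\<And>s. s \<ge> 0 \<Longrightarrow> norm (g s) \<le> B * exp (- s)"
    unfolding exp_decay_def by blast
  then have "norm (f s + g s) \<le> (A + B) * exp (- s)" if "s \<ge> 0" for s
    unfolding distrib_right using that by (intro norm_triangle_mono)
  moreover have "continuous_on {0..} (\<lambda>s. f s + g s)"
    using assms unfolding exp_decay_def by (intro continuous_on_add) auto
  ultimately show ?thesis unfolding exp_decay_def by blast
qed

lemma exp_decay_mult:
  fixes c :: "'a::real_normed_div_algebra"
  assumes "exp_decay f"
  shows "exp_decay (\<lambda>s. c * f s)"
proof -
  from assms obtain A where A: "\<And>s. s \<ge> 0 \<Longrightarrow> norm (f s) \<le> A * exp (- s)"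
    unfolding exp_decay_def by blast
  have "norm (c * f s) \<le> (norm c * A) * exp (- s)" if "s \<ge> 0" for s
    using mult_left_mono[OF A[OF that], of "norm c"] by (simp add: norm_mult mult.assoc)
  moreover have "continuous_on {0..} (\<lambda>s. c * f s)"
    using assms unfolding exp_decay_def by (intro continuous_intros) auto
  ultimately show ?thesis unfolding exp_decay_def by blast
qed

lemma exp_decay_diff:
  fixes f g :: "real \<Rightarrow> 'a::real_normed_div_algebra"
  assumes "exp_decay f" "exp_decay g"
  shows "exp_decay (\<lambda>s. f s - g s)"
  using exp_decay_add[OF assms(1) exp_decay_mult[OF assms(2), of "- 1"]] by simp

lemma exp_decay_integrable:
  fixes f :: "real \<Rightarrow> 'a::euclidean_space"
  assumes "exp_decay f"
  shows "f integrable_on {0..}"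
proof -
  from assms obtain C where C: "\<And>s. s \<ge> 0 \<Longrightarrow> norm (f s) \<le> C * exp (- s)" and cont: "continuous_on {0..} f"
    unfolding exp_decay_def by blast
  have "(\<lambda>s. C * exp (- s)) integrable_on {0..}"
    using integrable_on_exp_minus_to_infinity[of 1 0] by (intro integrable_on_mult_right) simp
  moreover have "f \<in> borel_measurable (lebesgue_on {0..})"
    using cont by (intro continuous_imp_measurable_on_sets_lebesgue) auto
  ultimately show ?thesis
    using measurable_bounded_by_integrable_imp_integrable[of f "{0..}" "\<lambda>s. C * exp (- s)"] C by simp
qed

text \<open>The truncations of \<open>f\<close> to \<open>{0..n}\<close> are dominated by \<open>C * exp (- s)\<close>, so their integrals, which the
fundamental theorem of calculus evaluates as \<open>G n - G 0\<close>, converge to the integral of \<open>f\<close>.\<close>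

lemma integral_FTC_at_infinity:
  fixes f :: "real \<Rightarrow> 'a::euclidean_space"
  assumes f: "exp_decay f"
    and G: "\<And>s. s \<ge> 0 \<Longrightarrow> (G has_vector_derivative f s) (at s within {0..})"
    and L: "(\<lambda>n. G (real n)) \<longlonglongrightarrow> L"
  shows "integral {0..} f = L - G 0"
proof -
  from f obtain C where C: "\<And>s. s \<ge> 0 \<Longrightarrow> norm (f s) \<le> C * exp (- s)" and cont: "continuous_on {0..} f"
    unfolding exp_decay_def by blast
  define F where "F n s = (if s \<in> {0..real n} then f s else 0)" for n :: nat and s
  have 0: "C \<ge> 0" using C[of 0] norm_ge_zero[of "f 0"] by (simp del: norm_ge_zero)
  have h: "(\<lambda>s. C * exp (- s)) integrable_on {0..}"
    using integrable_on_exp_minus_to_infinity[of 1 0] by (intro integrable_on_mult_right) simp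
  have part: "(f has_integral (G (real n) - G 0)) {0..real n}" for n
    by (intro fundamental_theorem_of_calculus)
       (auto intro: has_vector_derivative_within_subset[OF G])
  have F: "(F n has_integral (G (real n) - G 0)) {0..}" for n
    unfolding F_def
    by (rule has_integral_on_superset[where S = "{0..real n}"])
       (use has_integral_restrict[of "{0..real n}" "{0..real n}" f] part in \<open>auto\<close>)
  have "(\<lambda>n. integral {0..} (F n)) \<longlonglongrightarrow> integral {0..} f"
  proof (rule dominated_convergence(2)[OF _ h])
    show "F n integrable_on {0..}" for n using F by blast
    show "norm (F n s) \<le> C * exp (- s)" if "s \<in> {0..}" for n s
      using C[of s] that 0 by (auto simp: F_def)
    fix s :: real assume "s \<in> {0..}"
    then have "F n s = f s" if "n \<ge> nat \<lceil>s\<rceil>" for n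
      using that by (auto simp: F_def)
    then have "eventually (\<lambda>n. F n s = f s) sequentially"
      unfolding eventually_sequentially by blast
    then show "(\<lambda>n. F n s) \<longlonglongrightarrow> f s" by (rule tendsto_eventually)
  qed
  moreover have "(\<lambda>n. integral {0..} (F n)) = (\<lambda>n. G (real n) - G 0)"
    using integral_unique[OF F] by (rule ext)
  moreover have "(\<lambda>n. G (real n) - G 0) \<longlonglongrightarrow> L - G 0"
    by (intro tendsto_intros L)
  ultimately show ?thesis by (simp add: LIMSEQ_unique)
qed

lemma quartic_exp_decay:
  fixes K c :: real
  assumes "c > 0"
  shows "exp_decay (\<lambda>s. s ^ n * exp (K * s\<^sup>2 - c * s ^ 4))"
proof -
  let ?g = "\<lambda>s. s ^ n * exp (K * s\<^sup>2 - c * s ^ 4) * exp s"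
  have lim: "(?g \<longlongrightarrow> 0) at_top"
    using assms by real_asymp
  then have "eventually (\<lambda>s. norm (?g s) < 1) at_top"
    using tendstoD[OF lim, of 1] by (simp add: dist_norm)
  then obtain A where A: "\<And>s. s \<ge> A \<Longrightarrow> norm (?g s) < 1"
    by (auto simp: eventually_at_top_linorder)
  have "compact (?g ` {0..A})"
    by (intro compact_continuous_image continuous_intros) auto
  then have "bounded (?g ` {0..A})"
    by (rule compact_imp_bounded)
  then obtain B where "\<forall>x\<in>?g ` {0..A}. norm x \<le> B"
    unfolding bounded_iff by (elim exE)
  then have B: "norm (?g s) \<le> B" if "s \<in> {0..A}" for s
    using that by blast
  have *: "norm (s ^ n * exp (K * s\<^sup>2 - c * s ^ 4)) \<le> max 1 B * exp (- s)" if "s \<ge> 0" for s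
  proof -
    have "norm (?g s) \<le> max 1 B"
      using A[of s] B[of s] that by (cases "s \<ge> A") auto
    then show ?thesis
      using that by (simp add: exp_minus field_simps abs_mult)
  qed
  have "continuous_on {0..} (\<lambda>s. s ^ n * exp (K * s\<^sup>2 - c * s ^ 4))"
    by (intro continuous_intros)
  with * show ?thesis unfolding exp_decay_def by blast
qed

section \<open>A Laplace-type integral with quartic phase\<close>

text \<open>The central object is \<open>E(\<eta>) = \<integral> exp (- s ^ 4 / 2 - \<eta> * s ^ 2) ds\<close> over \<open>s \<ge> 0\<close>, the case \<open>k = 0\<close>.
Each derivative in \<open>\<eta>\<close> brings down a factor \<open>- s ^ 2\<close>, which is why the even moments come along:
\<open>E' = - quartic_laplace 1\<close> and \<open>E'' = quartic_laplace 2\<close>.\<close>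

definition quartic_laplace_integrand :: "nat \<Rightarrow> complex \<Rightarrow> real \<Rightarrow> complex" where
  "quartic_laplace_integrand k \<eta> s = of_real s ^ (2 * k) * exp (- (of_real s ^ 4 / 2) - \<eta> * of_real s ^ 2)"

definition quartic_laplace :: "nat \<Rightarrow> complex \<Rightarrow> complex" where
  "quartic_laplace k \<eta> = integral {0..} (quartic_laplace_integrand k \<eta>)"

lemma norm_quartic_laplace_integrand:
  "norm (quartic_laplace_integrand k \<eta> s) = s ^ (2 * k) * exp (- (s ^ 4 / 2) - Re \<eta> * s\<^sup>2)"
proof -
  have "(of_real s :: complex) ^ 4 / 2 = of_real (s ^ 4 / 2)" "(of_real s :: complex) ^ 2 = of_real (s\<^sup>2)"
    by simp_all
  then have "Re (- ((of_real s :: complex) ^ 4 / 2) - \<eta> * of_real s ^ 2) = - (s ^ 4 / 2) - Re \<eta> * s\<^sup>2"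
    by (simp only: ) simp
  then show ?thesis
    by (simp add: quartic_laplace_integrand_def norm_mult norm_power power_mult)
qed

lemma quartic_laplace_integrand_decay: "exp_decay (quartic_laplace_integrand k \<eta>)"
proof (rule exp_decayI)
  show "continuous_on {0..} (quartic_laplace_integrand k \<eta>)"
    unfolding quartic_laplace_integrand_def by (intro continuous_intros) auto
  show "exp_decay (\<lambda>s. s ^ (2 * k) * exp (- Re \<eta> * s\<^sup>2 - 1/2 * s ^ 4))"
    by (rule quartic_exp_decay) simp
  show "norm (quartic_laplace_integrand k \<eta> s) \<le> norm (s ^ (2 * k) * exp (- Re \<eta> * s\<^sup>2 - 1/2 * s ^ 4))" for s
  proof -
    have "- (s ^ 4 / 2) - Re \<eta> * s\<^sup>2 = - Re \<eta> * s\<^sup>2 - 1/2 * s ^ 4" by simp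
    then show ?thesis
      unfolding norm_quartic_laplace_integrand by (simp only:) (simp add: abs_mult power_mult)
  qed
qed

lemma norm_exp_minus_linear_le: "norm (exp (- w) - 1 + w) \<le> exp (norm w) * (norm w)\<^sup>2" for w :: complex
proof -
  have "norm (exp (- w) - (\<Sum>k\<le>1. (- w) ^ k / fact k)) \<le> exp \<bar>Re (- w)\<bar> * norm (- w) ^ Suc 1 / fact 1"
    by (rule Taylor_exp)
  also have "\<dots> \<le> exp (norm w) * (norm w)\<^sup>2"
    using abs_Re_le_cmod[of w] by (auto simp: power2_eq_square intro!: mult_right_mono)
  finally show ?thesis by (simp add: algebra_simps)
qed

text \<open>The Taylor bound for the exponential turns the error of the difference quotient into
\<open>norm h\<close> times an integral \<open>J\<close> that does not depend on \<open>h\<close>.\<close>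

lemma has_field_derivative_quartic_laplace:
  "(quartic_laplace k has_field_derivative - quartic_laplace (Suc k) \<eta>) (at \<eta>)"
proof -
  define J where "J = integral {0..} (\<lambda>s. s ^ (2 * k + 4) * exp ((norm \<eta> + 1) * s\<^sup>2 - 1/2 * s ^ 4))"
  have J: "(\<lambda>s. s ^ (2 * k + 4) * exp ((norm \<eta> + 1) * s\<^sup>2 - 1/2 * s ^ 4)) integrable_on {0..}"
    by (intro exp_decay_integrable quartic_exp_decay) simp
  have int: "quartic_laplace_integrand k \<eta> integrable_on {0..}" for k \<eta>
    by (intro exp_decay_integrable quartic_laplace_integrand_decay)
  have bound: "norm ((quartic_laplace k (\<eta> + h) - quartic_laplace k \<eta>) / h - - quartic_laplace (Suc k) \<eta>) \<le> norm h * J"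
    if h: "h \<noteq> 0" "norm h < 1" for h
  proof -
    let ?d = "\<lambda>s. quartic_laplace_integrand k (\<eta> + h) s - quartic_laplace_integrand k \<eta> s + h * quartic_laplace_integrand (Suc k) \<eta> s"
    have d: "norm (?d s) \<le> (norm h)\<^sup>2 * (s ^ (2 * k + 4) * exp ((norm \<eta> + 1) * s\<^sup>2 - 1/2 * s ^ 4))" for s
    proof -
      let ?w = "h * of_real s ^ 2"
      have nw: "norm ?w = norm h * s\<^sup>2" by (simp add: norm_mult norm_power)
      have "?d s = quartic_laplace_integrand k \<eta> s * (exp (- ?w) - 1 + ?w)"
      proof -
        have "- (of_real s ^ 4 / 2) - (\<eta> + h) * of_real s ^ 2 = (- (of_real s ^ 4 / 2) - \<eta> * of_real s ^ 2) + - ?w"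
          by (simp add: algebra_simps)
        then show ?thesis
          unfolding quartic_laplace_integrand_def by (simp only: exp_add) (simp add: algebra_simps power_add power2_eq_square)
      qed
      also have "norm \<dots> \<le> (s ^ (2 * k) * exp (- (s ^ 4 / 2) - Re \<eta> * s\<^sup>2)) * (exp (norm ?w) * (norm ?w)\<^sup>2)"
        by (subst norm_mult, subst norm_quartic_laplace_integrand, rule mult_left_mono[OF norm_exp_minus_linear_le])
           (simp add: power_mult)
      also have "\<dots> = (norm h)\<^sup>2 * (s ^ (2 * k + 4) * exp (norm h * s\<^sup>2 - (s ^ 4 / 2) - Re \<eta> * s\<^sup>2))"
      proof -
        have "norm h * s\<^sup>2 - (s ^ 4 / 2) - Re \<eta> * s\<^sup>2 = (- (s ^ 4 / 2) - Re \<eta> * s\<^sup>2) + norm h * s\<^sup>2"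
          by simp
        then have "exp (norm h * s\<^sup>2 - (s ^ 4 / 2) - Re \<eta> * s\<^sup>2) = exp (- (s ^ 4 / 2) - Re \<eta> * s\<^sup>2) * exp (norm h * s\<^sup>2)"
          by (simp only: exp_add)
        then show ?thesis
          unfolding nw by (simp add: power_mult_distrib power_add flip: power_mult)
      qed
      also have "\<dots> \<le> (norm h)\<^sup>2 * (s ^ (2 * k + 4) * exp ((norm \<eta> + 1) * s\<^sup>2 - 1/2 * s ^ 4))"
      proof -
        have "norm h * s\<^sup>2 \<le> 1 * s\<^sup>2" using h by (intro mult_right_mono) auto
        moreover have "- Re \<eta> * s\<^sup>2 \<le> norm \<eta> * s\<^sup>2"
          using abs_Re_le_cmod[of \<eta>] by (intro mult_right_mono) auto
        moreover have "s ^ (2 * k + 4) \<ge> 0" by (auto intro!: zero_le_even_power)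
        ultimately show ?thesis
          by (intro mult_left_mono) (auto simp: algebra_simps)
      qed
      finally show ?thesis .
    qed
    have "norm (integral {0..} ?d) \<le> integral {0..} (\<lambda>s. (norm h)\<^sup>2 * (s ^ (2 * k + 4) * exp ((norm \<eta> + 1) * s\<^sup>2 - 1/2 * s ^ 4)))"
      by (intro integral_norm_bound_integral integrable_add integrable_diff int integrable_on_mult_right J d)
    also have "\<dots> = (norm h)\<^sup>2 * J" unfolding J_def by simp
    also have "integral {0..} ?d = quartic_laplace k (\<eta> + h) - quartic_laplace k \<eta> + h * quartic_laplace (Suc k) \<eta>"
      unfolding quartic_laplace_def
      by (intro integral_unique has_integral_add has_integral_diff has_integral_mult_right integrable_integral int)
    finally have *: "norm (quartic_laplace k (\<eta> + h) - quartic_laplace k \<eta> + h * quartic_laplace (Suc k) \<eta>) \<le> (norm h)\<^sup>2 * J" .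
    have "(quartic_laplace k (\<eta> + h) - quartic_laplace k \<eta>) / h - - quartic_laplace (Suc k) \<eta>
       = (quartic_laplace k (\<eta> + h) - quartic_laplace k \<eta> + h * quartic_laplace (Suc k) \<eta>) / h"
      using h by (simp add: field_simps)
    also have "norm \<dots> \<le> (norm h)\<^sup>2 * J / norm h"
      unfolding norm_divide by (intro divide_right_mono *) auto
    also have "\<dots> = norm h * J" using h by (simp add: power2_eq_square)
    finally show ?thesis .
  qed
  have "((\<lambda>h. (quartic_laplace k (\<eta> + h) - quartic_laplace k \<eta>) / h - - quartic_laplace (Suc k) \<eta>) \<longlongrightarrow> 0) (at 0)"
  proof (rule Lim_null_comparison)
    show "\<forall>\<^sub>F h in at 0. norm ((quartic_laplace k (\<eta> + h) - quartic_laplace k \<eta>) / h - - quartic_laplace (Suc k) \<eta>) \<le> norm h * J"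
      unfolding eventually_at using bound by (intro exI[of _ 1]) (auto simp: dist_norm)
    show "((\<lambda>h. norm h * J) \<longlongrightarrow> 0) (at (0::complex))"
      by (auto intro!: tendsto_eq_intros)
  qed
  then show ?thesis unfolding DERIV_def by (rule LIM_zero_cancel)
qed

text \<open>In terms of \<open>E\<close> this is \<open>E'' - \<eta> * E' = E / 2\<close>. It comes from integrating the derivative of
\<open>s * exp (- s ^ 4 / 2 - \<eta> * s ^ 2)\<close>, whose boundary values vanish at \<open>0\<close> and at infinity.\<close>

lemma quartic_laplace_ode:
  "quartic_laplace 2 \<eta> + \<eta> * quartic_laplace 1 \<eta> = quartic_laplace 0 \<eta> / 2"
proof -
  define G where "G s = of_real s * exp (- (of_real s ^ 4 / 2) - \<eta> * of_real s ^ 2)" for s :: real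
  define f where "f s = quartic_laplace_integrand 0 \<eta> s
     - (2 * quartic_laplace_integrand 2 \<eta> s + 2 * \<eta> * quartic_laplace_integrand 1 \<eta> s)" for s
  have int: "quartic_laplace_integrand k \<eta> integrable_on {0..}" for k \<eta>
    by (intro exp_decay_integrable quartic_laplace_integrand_decay)
  have "exp_decay f"
    unfolding f_def by (intro exp_decay_diff exp_decay_add exp_decay_mult quartic_laplace_integrand_decay)
  moreover have "(G has_vector_derivative f s) (at s within {0..})" for s
  proof -
    have P: "((\<lambda>z. - (z ^ 4 / 2) - \<eta> * z ^ 2) has_field_derivative (- (2 * z ^ 3) - 2 * \<eta> * z)) (at z)" for z
      by (auto intro!: derivative_eq_intros)
    define z where "z = complex_of_real s"
    define e where "e = exp (- (z ^ 4 / 2) - \<eta> * z ^ 2)"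
    have "f s = e - (2 * (z ^ 4 * e) + 2 * \<eta> * (z\<^sup>2 * e))"
      by (simp add: f_def quartic_laplace_integrand_def e_def z_def)
    also have "\<dots> = 1 * e + e * (- (2 * z ^ 3) - 2 * \<eta> * z) * z"
      by (simp add: algebra_simps eval_nat_numeral)
    finally have "((\<lambda>z. z * exp (- (z ^ 4 / 2) - \<eta> * z ^ 2)) has_field_derivative f s) (at (of_real s))"
      using DERIV_mult[OF DERIV_ident DERIV_fun_exp[OF P], of z] by (simp only: e_def z_def)
    then show ?thesis
      unfolding G_def
      by (rule has_vector_derivative_real_field[unfolded o_def])
  qed
  moreover have "(\<lambda>n. G (real n)) \<longlonglongrightarrow> 0"
  proof (rule Lim_null_comparison)
    show "\<forall>\<^sub>F n in sequentially. norm (G (real n)) \<le> real n * exp (- (real n ^ 4 / 2) - Re \<eta> * (real n)\<^sup>2)"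
    proof (intro always_eventually allI)
      fix n
      show "norm (G (real n)) \<le> real n * exp (- (real n ^ 4 / 2) - Re \<eta> * (real n)\<^sup>2)"
        using norm_quartic_laplace_integrand[of 0 \<eta> "real n"]
        unfolding G_def quartic_laplace_integrand_def norm_mult by (simp del: norm_exp_eq_Re)
    qed
    show "(\<lambda>n. real n * exp (- (real n ^ 4 / 2) - Re \<eta> * (real n)\<^sup>2)) \<longlonglongrightarrow> 0"
      by real_asymp
  qed
  ultimately have "integral {0..} f = 0 - G 0"
    by (rule integral_FTC_at_infinity)
  moreover have "G 0 = 0" by (simp add: G_def)
  moreover have "integral {0..} f = quartic_laplace 0 \<eta> - (2 * quartic_laplace 2 \<eta> + 2 * \<eta> * quartic_laplace 1 \<eta>)"
    unfolding f_def quartic_laplace_def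
    by (intro integral_unique has_integral_add has_integral_diff has_integral_mult_right integrable_integral int)
  ultimately have "quartic_laplace 0 \<eta> = (quartic_laplace 2 \<eta> + \<eta> * quartic_laplace 1 \<eta>) * 2"
    by (simp add: algebra_simps)
  then show ?thesis by simp
qed

section \<open>Rotation of the ray of integration and asymptotics\<close>

text \<open>Cauchy's theorem for a circular sector, phrased through a primitive \<open>F\<close> of \<open>f\<close>: the two integrals up
to radius \<open>n\<close> differ by \<open>F n - F (n * cis a)\<close>, and along the arc from \<open>n\<close> to \<open>n * cis a\<close> the
derivative of \<open>F\<close> is exponentially small.\<close>

lemma integral_rotate_ray:
  fixes f :: "complex \<Rightarrow> complex"
  assumes holo: "f holomorphic_on UNIV"
    and bound: "\<And>u s. \<lbrakk>0 \<le> u; u \<le> 1; 0 \<le> s\<rbrakk> \<Longrightarrow> norm (f (of_real s * cis (u * a))) \<le> C * exp (- s)"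
  shows "integral {0..} (\<lambda>s. f (of_real s)) = cis a * integral {0..} (\<lambda>s. f (of_real s * cis a))"
    and "exp_decay (\<lambda>s. f (of_real s))" "exp_decay (\<lambda>s. f (of_real s * cis a))"
proof -
  have cont: "continuous_on {0..} (\<lambda>s. f (of_real s * w))" for w
    by (rule continuous_on_compose2[OF holomorphic_on_imp_continuous_on[OF holo]])
       (auto intro!: continuous_intros)
  show d1: "exp_decay (\<lambda>s. f (of_real s))"
    using bound[of 0] cont[of 1] unfolding exp_decay_def by auto
  show d2: "exp_decay (\<lambda>s. f (of_real s * cis a))"
    using bound[of 1] cont[of "cis a"] unfolding exp_decay_def by auto
  obtain F where "\<And>x. x \<in> UNIV \<Longrightarrow> (F has_field_derivative f x) (at x within UNIV)"
    using holomorphic_convex_primitive'[OF convex_UNIV open_UNIV holo] by blast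
  then have F: "(F has_field_derivative f x) (at x)" for x by simp
  have "integral {0..} (\<lambda>s. f (of_real s) - cis a * f (of_real s * cis a)) = 0 - (F (of_real 0) - F (of_real 0 * cis a))"
  proof (rule integral_FTC_at_infinity[where G = "\<lambda>s. F (of_real s) - F (of_real s * cis a)"])
    show "exp_decay (\<lambda>s. f (of_real s) - cis a * f (of_real s * cis a))"
      by (intro exp_decay_diff exp_decay_mult d1 d2)
    show "((\<lambda>s. F (of_real s) - F (of_real s * cis a)) has_vector_derivative
       f (of_real s) - cis a * f (of_real s * cis a)) (at s within {0..})" for s
    proof -
      have "((\<lambda>z. F (z * cis a)) has_field_derivative f (of_real s * cis a) * cis a) (at (of_real s))"
        by (rule DERIV_chain2[OF F]) (auto intro!: derivative_eq_intros)
      then have "((\<lambda>z. F z - F (z * cis a)) has_field_derivative f (of_real s) - cis a * f (of_real s * cis a)) (at (of_real s))"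
        by (subst mult.commute) (rule DERIV_diff[OF F])
      then show ?thesis by (rule has_vector_derivative_real_field)
    qed
    show "(\<lambda>n. F (of_real (real n)) - F (of_real (real n) * cis a)) \<longlonglongrightarrow> 0"
    proof (rule Lim_null_comparison)
      show "\<forall>\<^sub>F n in sequentially. norm (F (of_real (real n)) - F (of_real (real n) * cis a)) \<le> (real n * (C * exp (- real n))) * \<bar>a\<bar>"
      proof (intro always_eventually allI)
        fix n :: nat
        let ?P = "\<lambda>w. F (of_nat n * exp (\<i> * w))"
        have "norm (?P 0 - ?P (of_real a)) \<le> (real n * (C * exp (- real n))) * norm (0 - complex_of_real a)"
        proof (rule field_differentiable_bound[where S = "closed_segment 0 (complex_of_real a)"
               and f' = "\<lambda>w. f (of_nat n * exp (\<i> * w)) * (of_nat n * (exp (\<i> * w) * \<i>))"])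
          fix w assume "w \<in> closed_segment 0 (complex_of_real a)"
          then obtain u where u: "0 \<le> u" "u \<le> 1" and w: "w = of_real (u * a)"
            by (auto simp: in_segment scaleR_conv_of_real)
          have "((\<lambda>w. of_nat n * exp (\<i> * w)) has_field_derivative (of_nat n * (exp (\<i> * w) * \<i>))) (at w)"
            by (auto intro!: derivative_eq_intros)
          then have "(?P has_field_derivative f (of_nat n * exp (\<i> * w)) * (of_nat n * (exp (\<i> * w) * \<i>))) (at w)"
            by (rule DERIV_chain2[OF F])
          then show "(?P has_field_derivative f (of_nat n * exp (\<i> * w)) * (of_nat n * (exp (\<i> * w) * \<i>)))
               (at w within closed_segment 0 (complex_of_real a))"
            by (rule has_field_derivative_at_within)
          have e: "exp (\<i> * w) = cis (u * a)" by (simp add: w cis_conv_exp)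
          have "norm (f (of_nat n * exp (\<i> * w))) \<le> C * exp (- real n)"
            using bound[OF u, of "real n"] by (simp add: e)
          then have "real n * norm (f (of_nat n * exp (\<i> * w))) \<le> real n * (C * exp (- real n))"
            by (intro mult_left_mono) auto
          then show "norm (f (of_nat n * exp (\<i> * w)) * (of_nat n * (exp (\<i> * w) * \<i>))) \<le> real n * (C * exp (- real n))"
            by (simp add: norm_mult e mult.commute)
        qed auto
        then show "norm (F (of_real (real n)) - F (of_real (real n) * cis a)) \<le> (real n * (C * exp (- real n))) * \<bar>a\<bar>"
          by (simp add: cis_conv_exp)
      qed
      show "(\<lambda>n. (real n * (C * exp (- real n))) * \<bar>a\<bar>) \<longlonglongrightarrow> 0" by real_asymp
    qed
  qed
  moreover have "integral {0..} (\<lambda>s. f (of_real s) - cis a * f (of_real s * cis a))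
     = integral {0..} (\<lambda>s. f (of_real s)) - cis a * integral {0..} (\<lambda>s. f (of_real s * cis a))"
    by (intro integral_unique has_integral_diff has_integral_mult_right integrable_integral exp_decay_integrable d1 d2)
  ultimately show "integral {0..} (\<lambda>s. f (of_real s)) = cis a * integral {0..} (\<lambda>s. f (of_real s * cis a))"
    by simp
qed

lemma gaussian_has_integral:
  assumes "\<rho> > 0"
  shows "((\<lambda>s. exp (- \<rho> * s\<^sup>2)) has_integral sqrt pi / (2 * sqrt \<rho>)) {0..}"
proof -
  have "has_bochner_integral lborel (\<lambda>x. indicator {0..} (0 + sqrt \<rho> * x) *\<^sub>R exp (- (0 + sqrt \<rho> * x)\<^sup>2)) ((sqrt pi / 2) /\<^sub>R \<bar>sqrt \<rho>\<bar>)"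
    using gaussian_moment_0 assms by (subst (asm) lborel_has_bochner_integral_real_affine_iff[of "sqrt \<rho>" _ _ 0]) auto
  then have hb: "has_bochner_integral lborel (\<lambda>x. indicator {0..} (0 + sqrt \<rho> * x) *\<^sub>R exp (- (0 + sqrt \<rho> * x)\<^sup>2)) (sqrt pi / (2 * sqrt \<rho>))"
    using assms by (simp add: field_simps)
  have eq: "(\<lambda>x. indicator {0..} (0 + sqrt \<rho> * x) *\<^sub>R exp (- (0 + sqrt \<rho> * x)\<^sup>2)) = (\<lambda>x. if x \<in> {0..} then exp (- \<rho> * x\<^sup>2) else 0)"
    using assms by (auto simp: fun_eq_iff indicator_def power_mult_distrib zero_le_mult_iff)
  show ?thesis
    using has_integral_integral_lborel[OF integrable.intros[OF hb]] has_integral_restrict_UNIV[of "{0..}" "\<lambda>x. exp (- \<rho> * x\<^sup>2)"]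
    unfolding has_bochner_integral_integral_eq[OF hb] unfolding eq by simp
qed

text \<open>For \<open>\<bar>a\<bar> < pi / 4\<close> the function \<open>exp (- \<rho> * z ^ 2)\<close> still decays in the whole sector between the
positive axis and the ray of direction \<open>cis a\<close>, so the integral along that ray has the real value.\<close>

lemma gaussian_rotated:
  assumes "\<rho> > 0" "\<bar>a\<bar> < pi / 4"
  shows "cis a * integral {0..} (\<lambda>s. exp (- of_real \<rho> * (of_real s * cis a)\<^sup>2)) = of_real (sqrt pi / (2 * sqrt \<rho>))"
    and "exp_decay (\<lambda>s. exp (- of_real \<rho> * (of_real s * cis a)\<^sup>2))"
proof -
  define c where "c = \<rho> * cos (2 * a)"
  have c: "c > 0" using assms unfolding c_def by (intro mult_pos_pos cos_gt_zero_pi) auto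
  have bound: "norm (exp (- of_real \<rho> * (of_real s * cis (u * a))\<^sup>2)) \<le> exp (1 / (4 * c)) * exp (- s)"
    if u: "0 \<le> u" "u \<le> 1" "0 \<le> s" for u s
  proof -
    have "\<bar>2 * (u * a)\<bar> \<le> \<bar>2 * a\<bar>" using u by (simp add: abs_mult mult_left_le_one_le)
    then have "cos \<bar>2 * a\<bar> \<le> cos \<bar>2 * (u * a)\<bar>" using assms by (intro cos_monotone_0_pi_le) auto
    then have "c \<le> \<rho> * cos (2 * (u * a))" unfolding c_def using assms by (intro mult_left_mono) auto
    then have "c * s\<^sup>2 \<le> \<rho> * cos (2 * (u * a)) * s\<^sup>2" by (intro mult_right_mono) auto
    moreover have N: "norm (exp (- of_real \<rho> * (of_real s * cis (u * a))\<^sup>2)) = exp (- (\<rho> * cos (2 * (u * a)) * s\<^sup>2))"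
    proof -
      have "- of_real \<rho> * (of_real s * cis (u * a))\<^sup>2 = of_real (- (\<rho> * s\<^sup>2)) * cis (2 * (u * a))"
        by (simp add: power_mult_distrib Complex.DeMoivre)
      then show ?thesis by (simp only: norm_exp_eq_Re) (simp add: mult.commute mult.left_commute)
    qed
    moreover have "0 \<le> c * s\<^sup>2 - s + 1 / (4 * c)"
    proof -
      have "c * s\<^sup>2 - s + 1 / (4 * c) = c * (s - 1 / (2 * c))\<^sup>2" using c by (simp add: field_simps power2_eq_square)
      then show ?thesis using c by simp
    qed
    ultimately have "- (\<rho> * cos (2 * (u * a)) * s\<^sup>2) \<le> 1 / (4 * c) + - s"
      by linarith
    then show ?thesis unfolding N exp_add[symmetric] by (simp only: exp_le_cancel_iff)
  qed
  have holo: "(\<lambda>z. exp (- of_real \<rho> * z\<^sup>2)) holomorphic_on UNIV" by (intro holomorphic_intros)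
  note rot = integral_rotate_ray[of "\<lambda>z. exp (- of_real \<rho> * z\<^sup>2)", OF holo bound]
  show "exp_decay (\<lambda>s. exp (- of_real \<rho> * (of_real s * cis a)\<^sup>2))" using rot(3) by simp
  have "((\<lambda>s. complex_of_real (exp (- \<rho> * s\<^sup>2))) has_integral of_real (sqrt pi / (2 * sqrt \<rho>))) {0..}"
    by (rule has_integral_of_real[OF gaussian_has_integral[OF assms(1)]])
  then have "integral {0..} (\<lambda>s. exp (- of_real \<rho> * (of_real s)\<^sup>2)) = complex_of_real (sqrt pi / (2 * sqrt \<rho>))"
    by (intro integral_unique) (simp flip: exp_of_real)
  then show "cis a * integral {0..} (\<lambda>s. exp (- of_real \<rho> * (of_real s * cis a)\<^sup>2)) = of_real (sqrt pi / (2 * sqrt \<rho>))"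
    using rot(1) by simp
qed

lemma norm_exp_minus_one_le:
  assumes "Re w \<le> 0"
  shows "norm (exp w - 1) \<le> norm w" 
proof -
  have "norm (exp w - exp 0) \<le> 1 * norm (w - 0)"
  proof (rule field_differentiable_bound[where S = "{z. Re z \<le> 0}"])
    show "convex {z. Re z \<le> 0}" by (rule convex_halfspace_Re_le)
    show "(exp has_field_derivative exp z) (at z within {z. Re z \<le> 0})" for z :: complex
      by (rule DERIV_subset[OF DERIV_exp]) simp
  qed (use assms in auto)
  then show ?thesis by simp
qed

text \<open>Turning the ray of integration by \<open>- \<theta> / 6\<close>, where \<open>\<theta> = Arg \<eta>\<close>, gives \<open>s ^ 4\<close> the argument
\<open>- 2 * \<theta> / 3\<close> and \<open>\<eta> * s ^ 2\<close> the argument \<open>2 * \<theta> / 3\<close>; both exponents then decay precisely for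
\<open>\<bar>\<theta>\<bar> < 3 * pi / 4\<close>, and \<open>\<beta>\<close> bounds the cosine of these arguments from below. After the turn the
quartic term is dropped at the cost \<open>s ^ 4 / 2\<close> inside a Gaussian integral, which is smaller than the
remaining Gaussian integral by a factor of order \<open>(norm \<eta>) ^ 2\<close>; the latter is
\<open>sqrt pi / 2 * \<eta> powr (- 1 / 2)\<close>.\<close>

lemma quartic_laplace_asymptotic:
  assumes "\<eta> \<noteq> 0" "\<bar>Arg \<eta>\<bar> \<le> 3 * pi / 4 - \<delta>" "0 < \<delta>" "\<delta> \<le> 3 * pi / 4"
  defines "\<beta> \<equiv> sin (2 * \<delta> / 3)"
  shows "norm (quartic_laplace 0 \<eta> - of_real (sqrt pi / 2) * \<eta> powr (- 1 / 2))
     \<le> (4 / \<beta>\<^sup>2 * sqrt (2 / \<beta>)) / (norm \<eta>)\<^sup>2 * norm (of_real (sqrt pi / 2) * \<eta> powr (- 1 / 2))"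
proof -
  define \<rho> \<theta> a where "\<rho> = norm \<eta>" and "\<theta> = Arg \<eta>" and "a = - \<theta> / 6"
  have \<rho>: "\<rho> > 0" using assms by (simp add: \<rho>_def)
  have \<eta>: "\<eta> = of_real \<rho> * cis \<theta>"
    using rcis_cmod_Arg[of \<eta>] by (simp add: rcis_def \<rho>_def \<theta>_def)
  have \<theta>: "\<bar>\<theta>\<bar> \<le> 3 * pi / 4 - \<delta>" using assms by (simp add: \<theta>_def)
  have \<beta>0: "\<beta> > 0" unfolding \<beta>_def using assms by (intro sin_gt_zero) auto
  have \<beta>cos: "\<beta> \<le> cos \<psi>" if "\<bar>\<psi>\<bar> \<le> \<bar>2 * \<theta> / 3\<bar>" for \<psi>
  proof -
    have "cos (pi / 2 - 2 * \<delta> / 3) \<le> cos \<bar>\<psi>\<bar>" using that \<theta> assms by (intro cos_monotone_0_pi_le) auto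
    then show ?thesis by (simp add: \<beta>_def cos_diff)
  qed
  define f where "f z = exp (- (z ^ 4 / 2) - \<eta> * z\<^sup>2)" for z :: complex
  obtain C where C: "norm (s ^ 0 * exp (\<rho> * s\<^sup>2 - \<beta> / 2 * s ^ 4)) \<le> C * exp (- s)" if "s \<ge> 0" for s
    using quartic_exp_decay[of "\<beta> / 2" 0 \<rho>] \<beta>0 unfolding exp_decay_def by auto
  have bound: "norm (f (of_real s * cis (u * a))) \<le> C * exp (- s)" if u: "0 \<le> u" "u \<le> 1" "0 \<le> s" for u s
  proof -
    have e4: "(of_real s * cis (u * a)) ^ 4 = of_real (s ^ 4) * cis (4 * (u * a))"
      by (simp add: power_mult_distrib Complex.DeMoivre)
    have e2: "\<eta> * (of_real s * cis (u * a))\<^sup>2 = of_real (\<rho> * s\<^sup>2) * cis (\<theta> + 2 * (u * a))"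
      by (simp add: \<eta> power_mult_distrib Complex.DeMoivre cis_mult mult.left_commute)
    have "\<bar>4 * (u * a)\<bar> \<le> \<bar>4 * a\<bar>" using u by (simp add: abs_mult mult_left_le_one_le)
    then have "\<beta> \<le> cos (4 * (u * a))" by (intro \<beta>cos) (simp add: a_def)
    then have "\<beta> * s ^ 4 \<le> cos (4 * (u * a)) * s ^ 4" by (intro mult_right_mono) auto
    moreover have "- (\<rho> * s\<^sup>2) \<le> cos (\<theta> + 2 * (u * a)) * (\<rho> * s\<^sup>2)"
    proof -
      have "(-1) * (\<rho> * s\<^sup>2) \<le> cos (\<theta> + 2 * (u * a)) * (\<rho> * s\<^sup>2)" using \<rho> by (intro mult_right_mono) auto
      then show ?thesis by simp
    qed
    ultimately have "norm (f (of_real s * cis (u * a))) \<le> exp (\<rho> * s\<^sup>2 - \<beta> / 2 * s ^ 4)"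
      unfolding f_def e4 e2 by (simp add: mult.commute mult.left_commute)
    also have "\<dots> \<le> C * exp (- s)" using C[OF u(3)] by simp
    finally show ?thesis .
  qed
  have "f holomorphic_on UNIV" unfolding f_def by (intro holomorphic_intros) auto
  note rot = integral_rotate_ray[OF this bound]
  have "quartic_laplace 0 \<eta> = integral {0..} (\<lambda>s. f (of_real s))"
    unfolding quartic_laplace_def quartic_laplace_integrand_def f_def by simp
  then have E: "quartic_laplace 0 \<eta> = cis a * integral {0..} (\<lambda>s. f (of_real s * cis a))"
    using rot(1) by simp
  define g where "g s = exp (- of_real \<rho> * (of_real s * cis (\<theta> / 3))\<^sup>2)" for s
  have a3: "\<bar>\<theta> / 3\<bar> < pi / 4" using \<theta> assms by auto
  note gauss = gaussian_rotated[OF \<rho> a3, folded g_def]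
  have powr: "\<eta> powr (- 1 / 2) = cis (- \<theta> / 2) / of_real (sqrt \<rho>)"
  proof -
    have "\<eta> powr (- 1 / 2) = exp (- 1 / 2 * (of_real (ln \<rho>) + \<i> * of_real \<theta>))"
      using assms by (simp add: powr_def Ln_Arg \<rho>_def \<theta>_def)
    also have "\<dots> = exp (of_real (- ln \<rho> / 2)) * cis (- \<theta> / 2)"
      unfolding cis_conv_exp by (simp add: algebra_simps flip: exp_add)
    also have "exp (complex_of_real (- ln \<rho> / 2)) = of_real (exp (- ln \<rho> / 2))"
      by (rule exp_of_real)
    also have "exp (- ln \<rho> / 2) = 1 / sqrt \<rho>"
      using \<rho> by (simp add: exp_minus inverse_eq_divide flip: powr_half_sqrt) (simp add: powr_def)
    finally show ?thesis by simp
  qed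
  have main: "of_real (sqrt pi / 2) * \<eta> powr (- 1 / 2) = cis a * integral {0..} g"
  proof -
    have "of_real (sqrt pi / 2) * \<eta> powr (- 1 / 2) = cis (- \<theta> / 2) * of_real (sqrt pi / (2 * sqrt \<rho>))"
      unfolding powr by simp
    also have "\<dots> = cis (- \<theta> / 2) * (cis (\<theta> / 3) * integral {0..} g)"
      by (simp only: gauss(1))
    also have "\<dots> = cis (- \<theta> / 2) * cis (\<theta> / 3) * integral {0..} g"
      by (rule mult.assoc[symmetric])
    also have "cis (- \<theta> / 2) * cis (\<theta> / 3) = cis a" by (simp add: cis_mult a_def)
    finally show ?thesis .
  qed
  have if1: "(\<lambda>s. f (of_real s * cis a)) integrable_on {0..}" and ig: "g integrable_on {0..}"
    using exp_decay_integrable[OF rot(3)] exp_decay_integrable[OF gaussian_rotated(2)[OF \<rho> a3]]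
    unfolding g_def by auto
  have hi: "((\<lambda>s. 4 / (\<rho> * \<beta>)\<^sup>2 * exp (- (\<rho> * \<beta> / 2) * s\<^sup>2)) has_integral 4 / (\<rho> * \<beta>)\<^sup>2 * (sqrt pi / (2 * sqrt (\<rho> * \<beta> / 2)))) {0..}"
    using \<rho> \<beta>0 by (intro has_integral_mult_right gaussian_has_integral) auto
  have pt: "norm (f (of_real s * cis a) - g s) \<le> 4 / (\<rho> * \<beta>)\<^sup>2 * exp (- (\<rho> * \<beta> / 2) * s\<^sup>2)" for s
  proof -
    have e4: "(of_real s * cis a) ^ 4 = of_real (s ^ 4) * cis (4 * a)"
      by (simp add: power_mult_distrib Complex.DeMoivre)
    have e2: "\<eta> * (of_real s * cis a)\<^sup>2 = of_real (\<rho> * s\<^sup>2) * cis (2 * \<theta> / 3)"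
    proof -
      have "\<eta> * (of_real s * cis a)\<^sup>2 = of_real (\<rho> * s\<^sup>2) * cis (\<theta> + 2 * a)"
        by (simp add: \<eta> power_mult_distrib Complex.DeMoivre cis_mult mult.left_commute)
      also have "\<theta> + 2 * a = 2 * \<theta> / 3" by (simp add: a_def)
      finally show ?thesis .
    qed
    have e3: "of_real \<rho> * (of_real s * cis (\<theta> / 3))\<^sup>2 = of_real (\<rho> * s\<^sup>2) * cis (2 * \<theta> / 3)"
      by (simp add: power_mult_distrib Complex.DeMoivre)
    let ?X = "- (of_real (s ^ 4) * cis (4 * a) / 2)"
    have "f (of_real s * cis a) - g s = (exp ?X - 1) * exp (- (of_real (\<rho> * s\<^sup>2) * cis (2 * \<theta> / 3)))"
      unfolding f_def g_def e4 e2 mult_minus_left e3 left_diff_distrib exp_add[symmetric] by simp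
    then have eq: "norm (f (of_real s * cis a) - g s) = norm (exp ?X - 1) * exp (- (\<rho> * s\<^sup>2 * cos (2 * \<theta> / 3)))"
      by (simp add: norm_mult)
    have "norm (exp ?X - 1) \<le> norm ?X"
    proof (rule norm_exp_minus_one_le)
      have "\<beta> \<le> cos (4 * a)" by (intro \<beta>cos) (simp add: a_def)
      then have "0 \<le> cos (4 * a) * s ^ 4" using \<beta>0 by (intro mult_nonneg_nonneg) auto
      then show "Re ?X \<le> 0" by (simp add: mult.commute)
    qed
    also have "norm ?X = s ^ 4 / 2" by (simp add: norm_mult norm_divide norm_power)
    finally have X: "norm (exp ?X - 1) \<le> s ^ 4 / 2" .
    have "exp (- (\<rho> * s\<^sup>2 * cos (2 * \<theta> / 3))) \<le> exp (- (\<rho> * s\<^sup>2 * \<beta>))"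
    proof -
      have "\<beta> \<le> cos (2 * \<theta> / 3)" by (intro \<beta>cos) simp
      then have "\<rho> * s\<^sup>2 * \<beta> \<le> \<rho> * s\<^sup>2 * cos (2 * \<theta> / 3)" using \<rho> by (intro mult_left_mono) auto
      then show ?thesis by simp
    qed
    with X have "norm (f (of_real s * cis a) - g s) \<le> s ^ 4 / 2 * exp (- (\<rho> * s\<^sup>2 * \<beta>))"
      unfolding eq by (intro mult_mono) auto
    also have "s ^ 4 / 2 * exp (- (\<rho> * s\<^sup>2 * \<beta>)) \<le> 4 / (\<rho> * \<beta>)\<^sup>2 * exp (- (\<rho> * \<beta> / 2) * s\<^sup>2)"
    proof -
      (* Half of the Gaussian decay absorbs the factor s^4, since y^2 <= 8 exp(y/2). *)
      define y where "y = \<rho> * \<beta> * s\<^sup>2"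
      have y: "y \<ge> 0" using \<rho> \<beta>0 by (simp add: y_def)
      have "(y / 2)\<^sup>2 / 2 \<le> exp (y / 2)"
        using exp_lower_Taylor_quadratic[of "y / 2"] y by simp
      then have "y\<^sup>2 * exp (- y) \<le> 8 * exp (y / 2) * exp (- y)"
        by (intro mult_right_mono) (auto simp: power2_eq_square)
      also have "\<dots> = 8 * exp (- (y / 2))" by (simp flip: exp_add)
      finally have *: "y\<^sup>2 * exp (- y) \<le> 8 * exp (- (y / 2))" .
      have "s ^ 4 = y\<^sup>2 / (\<rho> * \<beta>)\<^sup>2"
        using \<rho> \<beta>0 by (simp add: y_def power_mult_distrib flip: power_mult)
      then have "s ^ 4 / 2 * exp (- (\<rho> * s\<^sup>2 * \<beta>)) = y\<^sup>2 * exp (- y) / (2 * (\<rho> * \<beta>)\<^sup>2)"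
        by (simp add: y_def mult.commute mult.left_commute)
      also have "\<dots> \<le> 8 * exp (- (y / 2)) / (2 * (\<rho> * \<beta>)\<^sup>2)"
        by (intro divide_right_mono *) simp
      finally show ?thesis by (simp add: y_def)
    qed
    finally show ?thesis .
  qed
  have "norm (integral {0..} (\<lambda>s. f (of_real s * cis a) - g s)) \<le> 4 / (\<rho> * \<beta>)\<^sup>2 * (sqrt pi / (2 * sqrt (\<rho> * \<beta> / 2)))"
    using integral_norm_bound_integral[OF integrable_diff[OF if1 ig] has_integral_integrable[OF hi] pt] integral_unique[OF hi] by simp
  then have "norm (quartic_laplace 0 \<eta> - of_real (sqrt pi / 2) * \<eta> powr (- 1 / 2)) \<le> 4 / (\<rho> * \<beta>)\<^sup>2 * (sqrt pi / (2 * sqrt (\<rho> * \<beta> / 2)))"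
    unfolding E main right_diff_distrib[symmetric] norm_mult
    by (simp add: integral_diff[OF if1 ig])
  also have "\<dots> = (4 / \<beta>\<^sup>2 * sqrt (2 / \<beta>)) / \<rho>\<^sup>2 * norm (of_real (sqrt pi / 2) * \<eta> powr (- 1 / 2))"
    unfolding powr using \<rho> \<beta>0
    by (simp add: norm_mult norm_divide real_sqrt_divide real_sqrt_mult power_mult_distrib)
  finally show ?thesis by (simp add: \<rho>_def)
qed

section \<open>Entire solutions of Weber's equation\<close>

text \<open>Solutions of Weber's equation for \<open>\<nu> = - 1 / 2\<close>, that is \<open>W'' = z ^ 2 / 4 * W\<close>, recorded together with
their derivative so that sums, multiples and rotations can be formed without computing \<open>deriv\<close>.\<close>

definition weber_solution :: "(complex \<Rightarrow> complex) \<Rightarrow> (complex \<Rightarrow> complex) \<Rightarrow> bool" where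
  "weber_solution W W' \<longleftrightarrow> (\<forall>z. (W has_field_derivative W' z) (at z) \<and> (W' has_field_derivative z\<^sup>2 / 4 * W z) (at z))"

text \<open>On a disc of radius \<open>r = 1 / B\<close> about \<open>z0\<close>, integrating the equation twice bounds the maximum \<open>M\<close> of
\<open>norm W\<close> by \<open>B / 4 * M * r ^ 2 \<le> M / 4\<close>. So \<open>W\<close> vanishes on the disc, and by the identity theorem
everywhere.\<close>

lemma weber_solution_unique:
  assumes W: "weber_solution W W'" and 0: "W z0 = 0" "W' z0 = 0"
  shows "W z = 0"
proof -
  have dW: "(W has_field_derivative W' z) (at z)" and dW': "(W' has_field_derivative z\<^sup>2 / 4 * W z) (at z)" for z
    using W unfolding weber_solution_def by auto
  define B where "B = (norm z0 + 1)\<^sup>2 + 1"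
  define r where "r = 1 / B"
  have B: "B \<ge> 1" by (simp add: B_def)
  have r: "r > 0" "r \<le> 1" using B by (auto simp: r_def)
  have cont: "continuous_on S W" for S
    using dW by (meson DERIV_isCont continuous_at_imp_continuous_on)
  have "\<exists>w\<in>cball z0 r. \<forall>y\<in>cball z0 r. norm (W y) \<le> norm (W w)"
    using r by (intro continuous_attains_sup continuous_on_norm cont) auto
  then obtain w where w: "w \<in> cball z0 r" and max: "\<And>y. y \<in> cball z0 r \<Longrightarrow> norm (W y) \<le> norm (W w)"
    by blast
  define M where "M = norm (W w)"
  have W'_bound: "norm (W' y) \<le> B / 4 * M * r" if y: "y \<in> cball z0 r" for y
  proof -
    have "norm (W' y - W' z0) \<le> (B / 4 * M) * norm (y - z0)"
    proof (rule field_differentiable_bound[where S = "cball z0 r"])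
      show "(W' has_field_derivative x\<^sup>2 / 4 * W x) (at x within cball z0 r)" for x
        by (rule has_field_derivative_at_within[OF dW'])
      fix x assume x: "x \<in> cball z0 r"
      have "norm x \<le> norm z0 + 1"
        using x r norm_triangle_ineq2[of x z0] by (simp add: dist_norm norm_minus_commute)
      then have "(norm x)\<^sup>2 \<le> (norm z0 + 1)\<^sup>2" by (intro power_mono) auto
      then have "(norm x)\<^sup>2 \<le> B" unfolding B_def by linarith
      then show "norm (x\<^sup>2 / 4 * W x) \<le> B / 4 * M"
        using max[OF x] B unfolding M_def norm_mult norm_divide norm_power by (intro mult_mono) auto
    qed (use y r in auto)
    also have "\<dots> \<le> (B / 4 * M) * r"
      using y B by (intro mult_left_mono) (auto simp: dist_norm norm_minus_commute M_def)
    finally show ?thesis using 0 by simp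
  qed
  have "norm (W w - W z0) \<le> (B / 4 * M * r) * norm (w - z0)"
    using w r by (intro field_differentiable_bound[where S = "cball z0 r" and f' = W'] has_field_derivative_at_within[OF dW] W'_bound) auto
  also have "\<dots> \<le> (B / 4 * M * r) * r"
    using w B r by (intro mult_left_mono) (auto simp: dist_norm norm_minus_commute M_def)
  also have "\<dots> = M * r / 4" using B by (simp add: r_def)
  also have "\<dots> \<le> M * 1 / 4" using r by (intro divide_right_mono mult_left_mono) (auto simp: M_def)
  finally have "M = 0" using 0 by (simp add: M_def)
  then have zero: "W y = 0" if "y \<in> ball z0 r" for y using max[of y] that by (simp add: M_def)
  show ?thesis
  proof (rule analytic_continuation[where f = W and w = z and S = UNIV and U = "ball z0 r" and \<xi> = z0])
    show "W holomorphic_on UNIV"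
      using dW by (auto simp: holomorphic_on_open)
    show "z0 islimpt ball z0 r" using r by (simp add: islimpt_ball)
  qed (use zero in auto)
qed

lemma weber_solution_add:
  assumes "weber_solution U U'" "weber_solution V V'"
  shows "weber_solution (\<lambda>z. U z + V z) (\<lambda>z. U' z + V' z)"
  using assms unfolding weber_solution_def distrib_left by (auto intro: DERIV_add)

lemma weber_solution_cmult:
  assumes "weber_solution U U'"
  shows "weber_solution (\<lambda>z. c * U z) (\<lambda>z. c * U' z)"
proof -
  have "((\<lambda>z. c * U z) has_field_derivative c * U' z) (at z)" for z
    using assms unfolding weber_solution_def by (intro DERIV_cmult) auto
  moreover have "((\<lambda>z. c * U' z) has_field_derivative z\<^sup>2 / 4 * (c * U z)) (at z)" for z
    using assms DERIV_cmult[of U' "z\<^sup>2 / 4 * U z" z UNIV c] unfolding weber_solution_def by (simp add: mult.left_commute)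
  ultimately show ?thesis unfolding weber_solution_def by blast
qed

text \<open>Two derivatives produce \<open>\<omega> ^ 2\<close> and the coefficient \<open>z ^ 2 / 4\<close> another \<open>\<omega> ^ 2\<close>, so the fourth roots of
unity act on the solutions.\<close>

lemma weber_solution_rotate:
  assumes "weber_solution U U'" "\<omega> ^ 4 = 1"
  shows "weber_solution (\<lambda>z. U (\<omega> * z)) (\<lambda>z. \<omega> * U' (\<omega> * z))"
proof -
  have lin: "((*) \<omega> has_field_derivative \<omega>) (at z)" for z
    by (auto intro!: derivative_eq_intros)
  have U: "(U has_field_derivative U' z) (at z)" and U': "(U' has_field_derivative z\<^sup>2 / 4 * U z) (at z)" for z
    using assms unfolding weber_solution_def by auto
  have "((\<lambda>z. U (\<omega> * z)) has_field_derivative \<omega> * U' (\<omega> * z)) (at z)" for z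
    using DERIV_chain2[OF U lin, of z] by (simp add: mult.commute)
  moreover have "((\<lambda>z. \<omega> * U' (\<omega> * z)) has_field_derivative z\<^sup>2 / 4 * U (\<omega> * z)) (at z)" for z
  proof -
    have "\<omega> * ((\<omega> * z)\<^sup>2 / 4 * U (\<omega> * z) * \<omega>) = \<omega> ^ 4 * (z\<^sup>2 / 4 * U (\<omega> * z))"
      by (simp add: power_mult_distrib power2_eq_square power4_eq_xxxx)
    also have "\<dots> = z\<^sup>2 / 4 * U (\<omega> * z)" using assms by simp
    finally show ?thesis using DERIV_cmult[OF DERIV_chain2[OF U' lin], of \<omega> z] by (simp only:)
  qed
  ultimately show ?thesis unfolding weber_solution_def by blast
qed

text \<open>The factor \<open>exp (- \<eta> ^ 2 / 4)\<close> transforms the equation for \<open>E\<close> into Weber's equation, and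
\<open>2 / sqrt pi\<close> normalizes the leading term \<open>sqrt pi / 2 * \<eta> powr (- 1 / 2)\<close> of \<open>E\<close>.\<close>

definition weber_D :: "complex \<Rightarrow> complex" where
  "weber_D \<eta> = of_real (2 / sqrt pi) * exp (- (\<eta>\<^sup>2 / 4)) * quartic_laplace 0 \<eta>"

definition weber_D' :: "complex \<Rightarrow> complex" where
  "weber_D' \<eta> = of_real (2 / sqrt pi) * exp (- (\<eta>\<^sup>2 / 4)) * (- (\<eta> / 2) * quartic_laplace 0 \<eta> - quartic_laplace 1 \<eta>)"

lemma weber_solution_weber_D: "weber_solution weber_D weber_D'"
proof -
  have q0: "(quartic_laplace 0 has_field_derivative - quartic_laplace 1 \<eta>) (at \<eta>)"
    and q1: "(quartic_laplace 1 has_field_derivative - quartic_laplace 2 \<eta>) (at \<eta>)" for \<eta>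
    using has_field_derivative_quartic_laplace[of 0 \<eta>] has_field_derivative_quartic_laplace[of 1 \<eta>]
    by (simp_all add: numeral_2_eq_2)
  define c where "c = complex_of_real (2 / sqrt pi)"
  have e: "((\<lambda>\<eta>. c * exp (- (\<eta>\<^sup>2 / 4))) has_field_derivative c * exp (- (\<eta>\<^sup>2 / 4)) * (- (\<eta> / 2))) (at \<eta>)" for \<eta>
    by (auto intro!: derivative_eq_intros)
  have l: "((\<lambda>\<eta>. - (\<eta> / 2)) has_field_derivative - (1 / 2)) (at \<eta>)" for \<eta> :: complex
    by (auto intro!: derivative_eq_intros)
  have "(weber_D has_field_derivative weber_D' \<eta>) (at \<eta>)" for \<eta>
    unfolding weber_D_def[abs_def] weber_D'_def c_def[symmetric]
    by (rule DERIV_cong[OF DERIV_mult[OF e q0]]) (simp add: algebra_simps)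
  moreover have "(weber_D' has_field_derivative \<eta>\<^sup>2 / 4 * weber_D \<eta>) (at \<eta>)" for \<eta>
  proof -
    let ?e = "c * exp (- (\<eta>\<^sup>2 / 4))"
    have alg: "e * (- (y / 2)) * (- (y / 2) * a0 - a1) + (- (1 / 2) * a0 + - a1 * - (y / 2) - - a2) * e
      = e * (y\<^sup>2 / 4 * a0 + (a2 + y * a1 - a0 / 2))" for e y a0 a1 a2 :: complex
      by (simp add: field_simps power2_eq_square)
    have "((\<lambda>\<eta>. c * exp (- (\<eta>\<^sup>2 / 4)) * (- (\<eta> / 2) * quartic_laplace 0 \<eta> - quartic_laplace 1 \<eta>)) has_field_derivative
       ?e * (- (\<eta> / 2)) * (- (\<eta> / 2) * quartic_laplace 0 \<eta> - quartic_laplace 1 \<eta>)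
       + (- (1 / 2) * quartic_laplace 0 \<eta> + - quartic_laplace 1 \<eta> * - (\<eta> / 2) - - quartic_laplace 2 \<eta>) * ?e) (at \<eta>)"
      by (rule DERIV_mult[OF e DERIV_diff[OF DERIV_mult[OF l q0] q1]])
    also have "?e * (- (\<eta> / 2)) * (- (\<eta> / 2) * quartic_laplace 0 \<eta> - quartic_laplace 1 \<eta>)
       + (- (1 / 2) * quartic_laplace 0 \<eta> + - quartic_laplace 1 \<eta> * - (\<eta> / 2) - - quartic_laplace 2 \<eta>) * ?e
      = ?e * (\<eta>\<^sup>2 / 4 * quartic_laplace 0 \<eta> + (quartic_laplace 2 \<eta> + \<eta> * quartic_laplace 1 \<eta> - quartic_laplace 0 \<eta> / 2))"
      by (rule alg)
    also have "\<dots> = \<eta>\<^sup>2 / 4 * weber_D \<eta>"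
      unfolding quartic_laplace_ode weber_D_def c_def by simp
    finally show ?thesis unfolding weber_D'_def[abs_def] c_def .
  qed
  ultimately show ?thesis unfolding weber_solution_def by blast
qed

text \<open>At \<open>\<eta> = 0\<close> the integrand is real and nonnegative, and at least \<open>exp (- 8)\<close> on \<open>{1..2}\<close>. Hence the
initial values of \<open>weber_D\<close> and \<open>weber_D'\<close> do not vanish, and \<open>weber_D\<close> together with a rotated copy
spans the solution space.\<close>

lemma quartic_laplace_at_0_nonzero: "quartic_laplace k 0 \<noteq> 0"
proof -
  define f :: "real \<Rightarrow> real" where "f s = s ^ (2 * k) * exp (0 * s\<^sup>2 - 1/2 * s ^ 4)" for s
  have d: "exp_decay f" unfolding f_def by (rule quartic_exp_decay) simp
  have "quartic_laplace_integrand k 0 = (\<lambda>s. of_real (f s))"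
    by (simp add: fun_eq_iff quartic_laplace_integrand_def f_def flip: exp_of_real)
  moreover have "((\<lambda>s. complex_of_real (f s)) has_integral of_real (integral {0..} f)) {0..}"
    by (rule has_integral_of_real[OF integrable_integral[OF exp_decay_integrable[OF d]]])
  ultimately have eq: "quartic_laplace k 0 = of_real (integral {0..} f)"
    unfolding quartic_laplace_def by (simp add: integral_unique)
  have f: "f s \<ge> exp (- 8)" if "s \<in> {1..2}" for s
  proof -
    have "s ^ 4 \<le> 2 ^ 4" using that by (intro power_mono) auto
    then have "exp (- 8) \<le> exp (- (1/2 * s ^ 4))" by simp
    moreover have "1 \<le> s ^ (2 * k)" using that by simp
    ultimately have "1 * exp (- 8) \<le> s ^ (2 * k) * exp (- (1/2 * s ^ 4))" by (intro mult_mono) auto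
    then show ?thesis by (simp add: f_def)
  qed
  have i12: "f integrable_on {1..2}"
    by (rule integrable_continuous_real) (auto simp: f_def[abs_def] intro!: continuous_intros)
  have "0 < exp (- 8 :: real)" by simp
  also have "\<dots> = integral {1..2::real} (\<lambda>_. exp (- 8 :: real))" by simp
  also have "\<dots> \<le> integral {1..2} f" by (intro integral_le i12 f) auto
  also have "\<dots> \<le> integral {0..} f"
    by (intro integral_subset_le i12 exp_decay_integrable d) (auto simp: f_def)
  finally show ?thesis unfolding eq by simp
qed

lemma weber_D_0: "weber_D 0 \<noteq> 0" "weber_D' 0 \<noteq> 0"
  using quartic_laplace_at_0_nonzero[of 0] quartic_laplace_at_0_nonzero[of 1]
  by (simp_all add: weber_D_def weber_D'_def)

text \<open>Both sides solve Weber's equation and agree to first order at \<open>0\<close>, because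
\<open>cis (pi / 4) + cis (- (pi / 4)) = sqrt 2\<close> and \<open>cis (pi / 4) - cis (- (pi / 4)) = \<i> * sqrt 2\<close>.\<close>

lemma weber_D_connection:
  "of_real (sqrt 2) * weber_D (\<i> * z) = cis (pi / 4) * weber_D z + cis (- (pi / 4)) * weber_D (- z)"
proof -
  have i4: "\<i> ^ 4 = 1" by (simp add: power4_eq_xxxx)
  have c: "cis (pi / 4) = of_real (sqrt 2 / 2) * (1 + \<i>)" "cis (- (pi / 4)) = of_real (sqrt 2 / 2) * (1 - \<i>)"
    by (simp_all add: complex_eq_iff cos_45 sin_45)
  have s: "weber_solution (\<lambda>z. - of_real (sqrt 2) * weber_D (\<i> * z) + (cis (pi / 4) * weber_D z + cis (- (pi / 4)) * weber_D (- 1 * z)))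
      (\<lambda>z. - of_real (sqrt 2) * (\<i> * weber_D' (\<i> * z)) + (cis (pi / 4) * weber_D' z + cis (- (pi / 4)) * (- 1 * weber_D' (- 1 * z))))"
    by (intro weber_solution_add weber_solution_cmult weber_solution_rotate weber_solution_weber_D i4) simp
  have "- of_real (sqrt 2) * weber_D (\<i> * z) + (cis (pi / 4) * weber_D z + cis (- (pi / 4)) * weber_D (- 1 * z)) = 0"
    by (rule weber_solution_unique[OF s, of 0]) (simp_all add: c field_simps)
  then show ?thesis by (simp add: add_eq_0_iff2)
qed

section \<open>The parabolic cylinder function of index -1/2\<close>

lemma weber_D_asymptotic:
  assumes "\<eta> \<noteq> 0" "\<bar>Arg \<eta>\<bar> \<le> 3 * pi / 4 - \<delta>" "0 < \<delta>" "\<delta> \<le> 3 * pi / 4"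
  shows "norm (weber_D \<eta> / (\<eta> powr (- 1 / 2) * exp (- (\<eta>\<^sup>2 / 4))) - 1)
    \<le> 4 / (sin (2 * \<delta> / 3))\<^sup>2 * sqrt (2 / sin (2 * \<delta> / 3)) / (norm \<eta>)\<^sup>2"
proof -
  define p where "p = \<eta> powr (- 1 / 2)"
  define c where "c = complex_of_real (sqrt pi / 2)"
  have p: "p \<noteq> 0" using assms by (simp add: p_def)
  have c: "c \<noteq> 0" by (simp add: c_def)
  have "complex_of_real (2 / sqrt pi) = 1 / c" by (simp add: c_def)
  then have "weber_D \<eta> / (p * exp (- (\<eta>\<^sup>2 / 4))) - 1 = (quartic_laplace 0 \<eta> - c * p) / (c * p)"
    using p c by (simp add: weber_D_def field_simps)
  then have "norm (weber_D \<eta> / (p * exp (- (\<eta>\<^sup>2 / 4))) - 1) = norm (quartic_laplace 0 \<eta> - c * p) / norm (c * p)"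
    by (simp only: norm_divide)
  also have "\<dots> \<le> 4 / (sin (2 * \<delta> / 3))\<^sup>2 * sqrt (2 / sin (2 * \<delta> / 3)) / (norm \<eta>)\<^sup>2"
    using quartic_laplace_asymptotic[OF assms] p c unfolding p_def[symmetric] c_def[symmetric]
    by (subst pos_divide_le_eq) auto
  finally show ?thesis unfolding p_def .
qed

lemma is_parabolic_cylinder_weber_D: "is_parabolic_cylinder (- 1 / 2) weber_D"
  unfolding is_parabolic_cylinder_def
proof (intro conjI allI impI)
  have dD: "(weber_D has_field_derivative weber_D' z) (at z)" and dD': "(weber_D' has_field_derivative z\<^sup>2 / 4 * weber_D z) (at z)" for z
    using weber_solution_weber_D unfolding weber_solution_def by auto
  show "weber_D holomorphic_on UNIV" using dD by (auto simp: holomorphic_on_open)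
  have "deriv weber_D = weber_D'" using dD by (auto simp: fun_eq_iff intro: DERIV_imp_deriv)
  then show "deriv (deriv weber_D) \<eta> + (- 1 / 2 + 1 / 2 - \<eta>\<^sup>2 / 4) * weber_D \<eta> = 0" for \<eta>
    using DERIV_imp_deriv[OF dD'] by simp
  fix \<delta> :: real assume \<delta>: "\<delta> > 0"
  define d where "d = min \<delta> (3 * pi / 4)"
  have d: "d > 0" "d \<le> 3 * pi / 4" "d \<le> \<delta>" using \<delta> by (auto simp: d_def)
  define K where "K = 4 / (sin (2 * d / 3))\<^sup>2 * sqrt (2 / sin (2 * d / 3))"
  let ?F = "inf at_infinity (principal {\<eta>. \<bar>Arg \<eta>\<bar> \<le> 3 * pi / 4 - \<delta>}) :: complex filter"
  have "((\<lambda>\<eta>. weber_D \<eta> / (\<eta> powr (- 1 / 2) * exp (- (\<eta>\<^sup>2 / 4))) - 1) \<longlongrightarrow> 0) ?F"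
  proof (rule Lim_null_comparison)
    have "eventually (\<lambda>\<eta>::complex. norm \<eta> \<ge> 1) at_infinity"
      unfolding eventually_at_infinity by blast
    then show "\<forall>\<^sub>F \<eta> in ?F. norm (weber_D \<eta> / (\<eta> powr (- 1 / 2) * exp (- (\<eta>\<^sup>2 / 4))) - 1) \<le> K / (norm \<eta>)\<^sup>2"
      unfolding eventually_inf_principal
    proof eventually_elim
      case (elim \<eta>)
      then have "\<eta> \<noteq> 0" by auto
      with weber_D_asymptotic[of \<eta> d] d show ?case unfolding K_def by auto
    qed
    have "((\<lambda>\<eta>::complex. K / (norm \<eta>)\<^sup>2) \<longlongrightarrow> 0) at_infinity"
      by (intro real_tendsto_divide_at_top[OF tendsto_const] filterlim_pow_at_top filterlim_norm_at_top) simp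
    then show "((\<lambda>\<eta>. K / (norm \<eta>)\<^sup>2) \<longlongrightarrow> 0) ?F"
      by (rule tendsto_mono[rotated]) simp
  qed
  then show "((\<lambda>\<eta>. weber_D \<eta> / (\<eta> powr (- 1 / 2) * exp (- (\<eta>\<^sup>2 / 4)))) \<longlongrightarrow> 1) ?F"
    by (rule LIM_zero_cancel)
qed

lemma is_parabolic_cylinder_along_ray:
  assumes D: "is_parabolic_cylinder \<nu> D" and u: "norm u = 1" "\<bar>Arg u\<bar> < 3 * pi / 4"
  shows "(\<lambda>n. D (of_nat n * u) / ((of_nat n * u) powr \<nu> * exp (- ((of_nat n * u)\<^sup>2 / 4)))) \<longlonglongrightarrow> 1"
proof -
  define \<delta> where "\<delta> = 3 * pi / 4 - \<bar>Arg u\<bar>"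
  have lim: "((\<lambda>\<eta>. D \<eta> / (\<eta> powr \<nu> * exp (- (\<eta>\<^sup>2 / 4)))) \<longlongrightarrow> 1) (inf at_infinity (principal {\<eta>. \<bar>Arg \<eta>\<bar> \<le> 3 * pi / 4 - \<delta>}))"
  proof -
    have "\<delta> > 0" using u by (simp add: \<delta>_def)
    then show ?thesis using D unfolding is_parabolic_cylinder_def by blast
  qed
  have "filterlim (\<lambda>n. of_nat n * u) (inf at_infinity (principal {\<eta>. \<bar>Arg \<eta>\<bar> \<le> 3 * pi / 4 - \<delta>})) sequentially"
    unfolding filterlim_inf filterlim_principal
  proof
    have "filterlim (\<lambda>n. norm (of_nat n * u)) at_top sequentially"
      using u by (simp add: norm_mult filterlim_real_sequentially)
    then show "filterlim (\<lambda>n. of_nat n * u) at_infinity sequentially"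
      by (rule filterlim_norm_at_top_imp_at_infinity)
    have "Arg (of_nat n * u) = Arg u" if "n > 0" for n
      using Arg_times_of_real[of "real n" u] that by simp
    then show "\<forall>\<^sub>F n in sequentially. of_nat n * u \<in> {\<eta>. \<bar>Arg \<eta>\<bar> \<le> 3 * pi / 4 - \<delta>}"
      by (intro eventually_mono[OF eventually_gt_at_top[of 0]]) (simp add: \<delta>_def)
  qed
  from filterlim_compose[OF lim this] show ?thesis .
qed

text \<open>Let \<open>D\<close> be any function with the defining properties. Matching initial values writes it as
\<open>a * weber_D z + b * weber_D (- \<i> * z)\<close>. Along the positive axis the second function grows like
\<open>exp (x ^ 2 / 4)\<close> while \<open>D\<close> and \<open>weber_D\<close> decay like \<open>exp (- x ^ 2 / 4)\<close>, which forces \<open>b = 0\<close>; the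
leading coefficient then forces \<open>a = 1\<close>.\<close>

lemma parabolic_cylinder_eq_weber_D: "parabolic_cylinder (- 1 / 2) = weber_D"
  unfolding parabolic_cylinder_def
proof (rule the_equality)
  show "is_parabolic_cylinder (- 1 / 2) weber_D" by (rule is_parabolic_cylinder_weber_D)
  fix D assume D: "is_parabolic_cylinder (- 1 / 2) D"
  have holo: "D holomorphic_on UNIV" and ode: "deriv (deriv D) z = z\<^sup>2 / 4 * D z" for z
  proof -
    show "D holomorphic_on UNIV" using D unfolding is_parabolic_cylinder_def by blast
    have "deriv (deriv D) z + (- 1 / 2 + 1 / 2 - z\<^sup>2 / 4) * D z = 0"
      using D unfolding is_parabolic_cylinder_def by blast
    then show "deriv (deriv D) z = z\<^sup>2 / 4 * D z" by simp
  qed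
  have DD: "weber_solution D (deriv D)"
    unfolding weber_solution_def
  proof (intro allI conjI)
    fix z
    show "(D has_field_derivative deriv D z) (at z)"
      using holo by (intro holomorphic_derivI[where S = UNIV]) auto
    have "deriv D holomorphic_on UNIV" using holo by (intro holomorphic_deriv) auto
    then have "(deriv D has_field_derivative deriv (deriv D) z) (at z)"
      by (intro holomorphic_derivI[where S = UNIV]) auto
    then show "(deriv D has_field_derivative z\<^sup>2 / 4 * D z) (at z)" by (simp add: ode)
  qed
  define A where "A = D 0 / weber_D 0"
  define B where "B = deriv D 0 / weber_D' 0"
  define b where "b = (A - B) / (1 + \<i>)"
  define a where "a = A - b"
  have i1: "1 + \<i> \<noteq> 0" by (simp add: complex_eq_iff)
  have ab: "a + b = A" by (simp add: a_def)
  have ab': "a - \<i> * b = B"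
  proof -
    have "(1 + \<i>) * b = A - B" using i1 by (simp add: b_def)
    then show ?thesis by (simp add: a_def algebra_simps)
  qed
  have mi: "(- \<i>) ^ 4 = 1" by (simp add: power4_eq_xxxx)
  have s: "weber_solution (\<lambda>z. D z + (- a * weber_D z + - b * weber_D (- \<i> * z)))
     (\<lambda>z. deriv D z + (- a * weber_D' z + - b * (- \<i> * weber_D' (- \<i> * z))))"
    by (intro weber_solution_add weber_solution_cmult weber_solution_rotate weber_solution_weber_D DD mi)
  have "D z + (- a * weber_D z + - b * weber_D (- \<i> * z)) = 0" for z
  proof (rule weber_solution_unique[OF s, of 0])
    have "D 0 = (a + b) * weber_D 0" using weber_D_0 by (simp add: ab A_def)
    then show "D 0 + (- a * weber_D 0 + - b * weber_D (- \<i> * 0)) = 0" by (simp add: algebra_simps)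
    have "deriv D 0 = (a - \<i> * b) * weber_D' 0" using weber_D_0 by (simp add: ab' B_def)
    then show "deriv D 0 + (- a * weber_D' 0 + - b * (- \<i> * weber_D' (- \<i> * 0))) = 0" by (simp add: algebra_simps)
  qed
  then have Deq: "D z = a * weber_D z + b * weber_D (- \<i> * z)" for z
    by (simp add: algebra_simps add_eq_0_iff)
  (* The prescribed leading terms along the positive real and the negative imaginary axis. *)
  define g where "g n = (of_nat n * (1::complex)) powr (- 1 / 2) * exp (- ((of_nat n * 1)\<^sup>2 / 4))" for n :: nat
  define h where "h n = (of_nat n * - \<i>) powr (- 1 / 2) * exp (- ((of_nat n * - \<i>)\<^sup>2 / 4))" for n :: nat
  have limD: "(\<lambda>n. D (of_nat n * 1) / g n) \<longlonglongrightarrow> 1"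
    unfolding g_def by (rule is_parabolic_cylinder_along_ray[OF D]) auto
  have limW: "(\<lambda>n. weber_D (of_nat n * 1) / g n) \<longlonglongrightarrow> 1"
    unfolding g_def by (rule is_parabolic_cylinder_along_ray[OF is_parabolic_cylinder_weber_D]) auto
  have limV: "(\<lambda>n. weber_D (of_nat n * - \<i>) / h n) \<longlonglongrightarrow> 1"
    unfolding h_def by (rule is_parabolic_cylinder_along_ray[OF is_parabolic_cylinder_weber_D]) auto
  have gh: "(\<lambda>n. g n / h n) \<longlonglongrightarrow> 0"
  proof (rule Lim_null_comparison)
    show "\<forall>\<^sub>F n in sequentially. norm (g n / h n) \<le> exp (- ((real n)\<^sup>2 / 2))"
      using eventually_gt_at_top[of 0]
    proof eventually_elim
      case (elim n)
      have "(of_nat n * - \<i>) powr (- 1 / 2) = of_nat n powr (- 1 / 2) * (- \<i>) powr (- 1 / 2)"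
        using powr_times_real_left[of "of_nat n" "- \<i>" "- 1 / 2"] by simp
      moreover have "norm ((- \<i>) powr (- 1 / 2)) = 1"
        by (simp add: powr_def)
      ultimately have "norm (g n / h n) = norm (exp (- ((of_nat n)\<^sup>2 / 4) :: complex) / exp ((of_nat n)\<^sup>2 / 4))"
        using elim by (simp add: g_def h_def norm_divide norm_mult power_mult_distrib)
      also have "\<dots> = exp (- ((real n)\<^sup>2 / 2))"
        by (simp add: norm_divide flip: exp_diff)
      finally show ?case by simp
    qed
    show "(\<lambda>n. exp (- ((real n)\<^sup>2 / 2))) \<longlonglongrightarrow> 0" by real_asymp
  qed
  have nz: "g n \<noteq> 0" "h n \<noteq> 0" if "n > 0" for n using that by (auto simp: g_def h_def)
  have "(\<lambda>n. (D (of_nat n * 1) / g n - a * (weber_D (of_nat n * 1) / g n)) * (g n / h n)) \<longlonglongrightarrow> (1 - a * 1) * 0"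
    by (intro tendsto_intros limD limW gh)
  moreover have "\<forall>\<^sub>F n in sequentially. (D (of_nat n * 1) / g n - a * (weber_D (of_nat n * 1) / g n)) * (g n / h n) = b * (weber_D (of_nat n * - \<i>) / h n)"
    by (intro eventually_mono[OF eventually_gt_at_top[of 0]]) (use nz Deq in \<open>simp add: field_simps\<close>)
  ultimately have "(\<lambda>n. b * (weber_D (of_nat n * - \<i>) / h n)) \<longlonglongrightarrow> (1 - a * 1) * 0"
    by (rule Lim_transform_eventually)
  moreover have "(\<lambda>n. b * (weber_D (of_nat n * - \<i>) / h n)) \<longlonglongrightarrow> b * 1"
    by (intro tendsto_intros limV)
  ultimately have "(1 - a * 1) * 0 = b * 1" by (rule LIMSEQ_unique)
  then have b: "b = 0" by simp
  have "(\<lambda>n. a * (weber_D (of_nat n * 1) / g n)) \<longlonglongrightarrow> a * 1"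
    by (intro tendsto_intros limW)
  then have "(\<lambda>n. D (of_nat n * 1) / g n) \<longlonglongrightarrow> a" by (simp add: Deq b)
  then have a: "a = 1" using limD LIMSEQ_unique by blast
  show "D = weber_D" using Deq a b by auto
qed

text \<open>With \<open>z = cis (pi / 4) * \<xi>\<close> the two arguments in \<open>q_ell\<close> are \<open>- z\<close> and \<open>\<i> * z\<close>. The connection formula
expresses \<open>weber_D (\<i> * z)\<close> through \<open>weber_D z\<close> and \<open>weber_D (- z)\<close>, and the terms with \<open>weber_D (- z)\<close>
cancel.\<close>

lemma q_ell_eq_weber_D: "q_ell \<xi> = cis (- (pi / 4)) * weber_D (cis (pi / 4) * \<xi>)"
proof -
  define z where "z = cis (pi / 4) * \<xi>"
  have e1: "exp (of_real pi * \<i> / 4) = cis (pi / 4)" by (simp add: cis_conv_exp mult.commute)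
  have e3: "exp (- (3 * of_real pi * \<i> / 4)) * \<xi> = - z"
  proof -
    have "exp (- (3 * of_real pi * \<i> / 4)) = cis (- (3 * pi / 4))" by (simp add: cis_conv_exp algebra_simps)
    also have "- (3 * pi / 4) = pi / 4 - pi" by simp
    also have "cis (pi / 4 - pi) = cis (pi / 4) / cis pi" by (rule cis_divide[symmetric])
    also have "\<dots> = - cis (pi / 4)" by simp
    finally show ?thesis by (simp add: z_def)
  qed
  have e5: "exp (- (5 * of_real pi * \<i> / 4)) * \<xi> = \<i> * z"
  proof -
    have "exp (- (5 * of_real pi * \<i> / 4)) = cis (- (5 * pi / 4))" by (simp add: cis_conv_exp algebra_simps)
    also have "- (5 * pi / 4) = (pi / 4 + pi / 2) - 2 * pi" by simp
    also have "cis ((pi / 4 + pi / 2) - 2 * pi) = cis (pi / 4) * cis (pi / 2) / cis (2 * pi)"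
      by (simp only: cis_mult cis_divide)
    also have "\<dots> = \<i> * cis (pi / 4)" by simp
    finally show ?thesis by (simp add: z_def)
  qed
  have c: "\<i> * cis (pi / 4) = - cis (- (pi / 4))" "\<i> * cis (- (pi / 4)) = cis (pi / 4)"
    by (simp_all add: complex_eq_iff cos_45 sin_45)
  have "q_ell \<xi> = cis (pi / 4) * weber_D (- z) - \<i> * (of_real (sqrt 2) * weber_D (\<i> * z))"
    unfolding q_ell_def parabolic_cylinder_eq_weber_D e1 e3 e5 by (simp add: mult.assoc)
  also have "\<dots> = (cis (pi / 4) - \<i> * cis (- (pi / 4))) * weber_D (- z) - (\<i> * cis (pi / 4)) * weber_D z"
    unfolding weber_D_connection by (simp add: algebra_simps)
  also have "\<dots> = cis (- (pi / 4)) * weber_D z" unfolding c by simp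
  finally show ?thesis by (simp add: z_def)
qed

section \<open>An Euler integral for the Jacobi polynomials\<close>

text \<open>The substitution \<open>t = s ^ 2\<close> turns twice this integral into Euler's Beta integral
\<open>B(k + 1/2, m + 1)\<close>.\<close>

definition beta_moment :: "nat \<Rightarrow> nat \<Rightarrow> real" where
  "beta_moment m k = integral {0..1} (\<lambda>s. s ^ (2 * k) * (1 - s\<^sup>2) ^ m)"

lemma beta_moment_integrable: "(\<lambda>s. s ^ (2 * k) * (1 - s\<^sup>2) ^ m) integrable_on {0..1::real}"
  by (intro integrable_continuous_real continuous_intros)

text \<open>Integrate the derivative of \<open>s ^ (2 * k + 1) * (1 - s ^ 2) ^ (m + 1)\<close>, which vanishes at both ends.\<close>

lemma beta_moment_Suc: "(2 * real k + 2 * real m + 3) * beta_moment m (Suc k) = (2 * real k + 1) * beta_moment m k"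
proof -
  have "((\<lambda>s. (2 * real k + 1) * (s ^ (2 * k) * (1 - s\<^sup>2) ^ m) - (2 * real k + 2 * real m + 3) * (s ^ (2 * Suc k) * (1 - s\<^sup>2) ^ m))
     has_integral (1 ^ (2 * k + 1) * (1 - 1\<^sup>2) ^ Suc m - 0 ^ (2 * k + 1) * (1 - 0\<^sup>2) ^ Suc m)) {0..1::real}"
  proof (rule fundamental_theorem_of_calculus)
    fix s :: real assume "s \<in> {0..1}"
    have p1: "((\<lambda>s. s ^ (2 * k + 1)) has_field_derivative (2 * real k + 1) * s ^ (2 * k)) (at s)"
      by (rule derivative_eq_intros refl)+ simp
    have p2: "((\<lambda>s. (1 - s\<^sup>2) ^ Suc m) has_field_derivative - (2 * (real m + 1) * s * (1 - s\<^sup>2) ^ m)) (at s)"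
      by (rule derivative_eq_intros refl)+ (simp add: algebra_simps)
    have "((\<lambda>s. s ^ (2 * k + 1) * (1 - s\<^sup>2) ^ Suc m) has_field_derivative
       (2 * real k + 1) * (s ^ (2 * k) * (1 - s\<^sup>2) ^ m) - (2 * real k + 2 * real m + 3) * (s ^ (2 * Suc k) * (1 - s\<^sup>2) ^ m)) (at s)"
      by (rule DERIV_cong[OF DERIV_mult[OF p1 p2]]) (simp add: algebra_simps power2_eq_square)
    then show "((\<lambda>s. s ^ (2 * k + 1) * (1 - s\<^sup>2) ^ Suc m) has_vector_derivative
       (2 * real k + 1) * (s ^ (2 * k) * (1 - s\<^sup>2) ^ m) - (2 * real k + 2 * real m + 3) * (s ^ (2 * Suc k) * (1 - s\<^sup>2) ^ m)) (at s within {0..1})"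
      by (simp add: has_real_derivative_iff_has_vector_derivative has_vector_derivative_at_within)
  qed simp
  moreover have "((\<lambda>s. (2 * real k + 1) * (s ^ (2 * k) * (1 - s\<^sup>2) ^ m) - (2 * real k + 2 * real m + 3) * (s ^ (2 * Suc k) * (1 - s\<^sup>2) ^ m))
     has_integral ((2 * real k + 1) * beta_moment m k - (2 * real k + 2 * real m + 3) * beta_moment m (Suc k))) {0..1::real}"
    unfolding beta_moment_def by (intro has_integral_diff has_integral_mult_right integrable_integral beta_moment_integrable)
  ultimately have "(2 * real k + 1) * beta_moment m k - (2 * real k + 2 * real m + 3) * beta_moment m (Suc k)
    = 1 ^ (2 * k + 1) * (1 - 1\<^sup>2) ^ Suc m - 0 ^ (2 * k + 1) * (1 - 0\<^sup>2) ^ Suc m"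
    by (rule has_integral_unique[rotated])
  then show ?thesis by simp
qed

lemma beta_moment_pos: "beta_moment m 0 > 0"
proof -
  have nonneg: "s \<in> {0..1} \<Longrightarrow> 0 \<le> (1 - s\<^sup>2) ^ m" for s :: real
    by (intro zero_le_power) (auto simp: power_le_one)
  have "integral {0..1} (\<lambda>s::real. (1 - s\<^sup>2) ^ m) \<noteq> 0"
  proof
    assume "integral {0..1} (\<lambda>s::real. (1 - s\<^sup>2) ^ m) = 0"
    then have "\<forall>s\<in>{0..1::real}. (1 - s\<^sup>2) ^ m = 0"
      using nonneg by (subst (asm) integral_eq_0_iff) (auto intro!: continuous_intros)
    then have "(1 - (0::real)\<^sup>2) ^ m = 0" by (rule bspec) simp
    then show False by simp
  qed
  moreover have "beta_moment m 0 \<ge> 0"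
    using beta_moment_integrable[of 0 m] nonneg unfolding beta_moment_def by (intro integral_nonneg) auto
  ultimately show ?thesis by (simp add: beta_moment_def)
qed

lemma gbinomial_Suc_mult: "of_nat (Suc k) * (a gchoose Suc k) = (a - of_nat k) * (a gchoose k)"
  for a :: "'a::field_char_0"
  by (simp only: gbinomial_absorption gbinomial_absorb_comp)

text \<open>The \<open>k\<close>-th coefficient of the Jacobi polynomial is proportional to a binomial coefficient times a Beta
integral, with a constant independent of \<open>k\<close>: passing from \<open>k\<close> to \<open>k + 1\<close> multiplies both sides by the
same rational number. In the induction step both sides are multiplied by the two denominators
\<open>2 * m + 1 / 2 - j\<close> and \<open>k + 1\<close>.\<close>

lemma gbinomial_mult_beta_moment:
  assumes "k \<le> m"
  shows "((2 * of_nat m + 1 / 2) gchoose (m - k)) * ((- 1 / 2) gchoose k) * of_real (beta_moment m 0)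
    = ((2 * of_nat m + 1 / 2 :: complex) gchoose m) * ((- 1) ^ k * of_nat (m choose k) * of_real (beta_moment m k))"
  using assms
proof (induction k)
  case 0
  show ?case by simp
next
  case (Suc k)
  define x :: complex where "x = 2 * of_nat m + 1 / 2"
  define X where "X = x gchoose m"
  define j where "j = m - Suc k"
  define B where "B i = complex_of_real (beta_moment m i)" for i
  define h where "h = (gchoose) (- 1 / 2 :: complex)"
  have mk: "m - k = Suc j" and m: "m = j + k + 1" using Suc.prems by (auto simp: j_def)
  have g1: "(x - of_nat j) * (x gchoose j) = of_nat (Suc j) * (x gchoose Suc j)"
    by (rule gbinomial_Suc_mult[symmetric])
  have g2: "of_nat (Suc k) * h (Suc k) = (- 1 / 2 - of_nat k) * h k"
    unfolding h_def by (rule gbinomial_Suc_mult)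
  have g3: "of_nat (Suc k) * (of_nat (m choose Suc k) :: complex) = of_nat (Suc j) * of_nat (m choose k)"
  proof -
    have "of_nat m - of_nat k = (of_nat (Suc j) :: complex)" by (simp add: m)
    then show ?thesis
      using gbinomial_Suc_mult[of k "of_nat m :: complex"] unfolding binomial_gbinomial by (simp only:)
  qed
  have b: "(2 * of_nat k + 2 * of_nat m + 3) * B (Suc k) = (2 * of_nat k + 1) * B k"
    using arg_cong[OF beta_moment_Suc[of k m], of complex_of_real] by (simp add: B_def)
  have xj: "x - of_nat j = (2 * of_nat k + 2 * of_nat m + 3) / 2" by (simp add: x_def m field_simps)
  have IH: "(x gchoose Suc j) * h k * B 0 = X * ((- 1) ^ k * of_nat (m choose k) * B k)"
    using Suc.IH Suc.prems by (simp add: mk x_def X_def h_def B_def)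
  have "((x - of_nat j) * of_nat (Suc k)) * ((x gchoose j) * h (Suc k) * B 0)
     = ((x - of_nat j) * (x gchoose j)) * (of_nat (Suc k) * h (Suc k)) * B 0" by (simp only: ac_simps)
  also have "\<dots> = (of_nat (Suc j) * (- 1 / 2 - of_nat k)) * ((x gchoose Suc j) * h k * B 0)"
    unfolding g1 g2 by (simp only: ac_simps)
  also have "\<dots> = X * ((- 1) ^ Suc k * (of_nat (Suc j) * of_nat (m choose k)) * ((2 * of_nat k + 1) * B k / 2))"
    unfolding IH by (simp add: field_simps)
  also have "\<dots> = ((x - of_nat j) * of_nat (Suc k)) * (X * ((- 1) ^ Suc k * of_nat (m choose Suc k) * B (Suc k)))"
    unfolding g3[symmetric] b[symmetric] xj by (simp only: ac_simps times_divide_eq_right times_divide_eq_left)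
  finally have "((x - of_nat j) * of_nat (Suc k)) * ((x gchoose j) * h (Suc k) * B 0)
     = ((x - of_nat j) * of_nat (Suc k)) * (X * ((- 1) ^ Suc k * of_nat (m choose Suc k) * B (Suc k)))" .
  moreover have "(x - of_nat j) * of_nat (Suc k) \<noteq> 0"
  proof -
    have "Re (x - of_nat j) > 0" by (simp add: x_def m)
    then have "x - of_nat j \<noteq> 0" by auto
    then show ?thesis using of_nat_neq_0 by (metis mult_eq_0_iff)
  qed
  ultimately have "(x gchoose j) * h (Suc k) * B 0 = X * ((- 1) ^ Suc k * of_nat (m choose Suc k) * B (Suc k))"
    by (rule mult_left_cancel[THEN iffD1, rotated])
  then show ?case by (simp only: j_def x_def X_def h_def B_def)
qed

definition jacobi_integral :: "nat \<Rightarrow> complex \<Rightarrow> complex" where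
  "jacobi_integral m z = integral {0..1} (\<lambda>s. ((1 - of_real s ^ 2) * (1 + (1 - z) / (1 + z) * of_real s ^ 2)) ^ m)"

definition jacobi_coeff :: "nat \<Rightarrow> complex" where
  "jacobi_coeff m = ((2 * of_nat m + 1 / 2) gchoose m) / (2 ^ m * of_real (beta_moment m 0))"

lemma jacobi_coeff_nonzero: "jacobi_coeff m \<noteq> 0"
proof -
  have "(2 * of_nat m + 1 / 2 :: complex) - of_nat i \<noteq> 0" if "i < m" for i
  proof -
    have "Re ((2 * of_nat m + 1 / 2 :: complex) - of_nat i) > 0" using that by simp
    then show ?thesis by (metis less_irrefl zero_complex.sel(1))
  qed
  then have "fact m * ((2 * of_nat m + 1 / 2 :: complex) gchoose m) \<noteq> 0"
    unfolding gbinomial_mult_fact by (simp add: prod_zero_iff)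
  then show ?thesis using beta_moment_pos[of m] by (simp add: jacobi_coeff_def)
qed

text \<open>Expanding \<open>((1 - z) * s ^ 2 + (1 + z)) ^ m\<close> by the binomial theorem and integrating against
\<open>(1 - s ^ 2) ^ m\<close> term by term gives the coefficients of the previous lemma.\<close>

lemma jacobi_P_eq_integral:
  assumes "1 + z \<noteq> 0"
  shows "jacobi_P m z = jacobi_coeff m * (1 + z) ^ m * jacobi_integral m z"
proof -
  define G where "G = (2 * of_nat m + 1 / 2 :: complex) gchoose m"
  have B0: "complex_of_real (beta_moment m 0) \<noteq> 0" using beta_moment_pos[of m] by simp
  have "((\<lambda>s. \<Sum>k\<le>m. of_nat (m choose k) * (1 - z) ^ k * (1 + z) ^ (m - k) * complex_of_real (s ^ (2 * k) * (1 - s\<^sup>2) ^ m))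
      has_integral (\<Sum>k\<le>m. of_nat (m choose k) * (1 - z) ^ k * (1 + z) ^ (m - k) * of_real (beta_moment m k))) {0..1}"
    unfolding beta_moment_def
    by (intro has_integral_sum has_integral_mult_right has_integral_of_real integrable_integral beta_moment_integrable) auto
  moreover have "(\<Sum>k\<le>m. of_nat (m choose k) * (1 - z) ^ k * (1 + z) ^ (m - k) * complex_of_real (s ^ (2 * k) * (1 - s\<^sup>2) ^ m))
     = (1 + z) ^ m * ((1 - of_real s ^ 2) * (1 + (1 - z) / (1 + z) * of_real s ^ 2)) ^ m" for s
  proof -
    have "(1 + z) ^ m * ((1 - of_real s ^ 2) * (1 + (1 - z) / (1 + z) * of_real s ^ 2)) ^ m
       = (1 - of_real s ^ 2) ^ m * ((1 - z) * of_real s ^ 2 + (1 + z)) ^ m"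
      unfolding power_mult_distrib[symmetric] using assms by (intro arg_cong[of _ _ "\<lambda>x. x ^ m"]) (simp add: field_simps)
    also have "\<dots> = (\<Sum>k\<le>m. of_nat (m choose k) * (1 - z) ^ k * (1 + z) ^ (m - k) * complex_of_real (s ^ (2 * k) * (1 - s\<^sup>2) ^ m))"
      unfolding binomial_ring[of "(1 - z) * of_real s ^ 2" "1 + z"] sum_distrib_left
      by (intro sum.cong refl) (simp add: power_mult_distrib mult_ac flip: power_mult)
    finally show ?thesis by simp
  qed
  ultimately have "((\<lambda>s. (1 + z) ^ m * ((1 - of_real s ^ 2) * (1 + (1 - z) / (1 + z) * of_real s ^ 2)) ^ m)
     has_integral (\<Sum>k\<le>m. of_nat (m choose k) * (1 - z) ^ k * (1 + z) ^ (m - k) * of_real (beta_moment m k))) {0..1}"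
    by simp
  then have int: "(1 + z) ^ m * jacobi_integral m z = (\<Sum>k\<le>m. of_nat (m choose k) * (1 - z) ^ k * (1 + z) ^ (m - k) * of_real (beta_moment m k))"
    unfolding jacobi_integral_def by (subst integral_mult_right[symmetric]) (rule integral_unique)
  have "jacobi_coeff m * (1 + z) ^ m * jacobi_integral m z
    = G / (2 ^ m * of_real (beta_moment m 0)) * (\<Sum>k\<le>m. of_nat (m choose k) * (1 - z) ^ k * (1 + z) ^ (m - k) * of_real (beta_moment m k))"
    unfolding mult.assoc int by (simp add: jacobi_coeff_def G_def)
  also have "\<dots> = 1 / 2 ^ m * (\<Sum>k\<le>m. ((2 * of_nat m + 1 / 2) gchoose (m - k)) * ((- 1 / 2) gchoose k) * (z - 1) ^ k * (z + 1) ^ (m - k))"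
    unfolding sum_distrib_left
  proof (intro sum.cong refl)
    fix k assume "k \<in> {..m}"
    then have k: "((2 * of_nat m + 1 / 2) gchoose (m - k)) * ((- 1 / 2) gchoose k)
       = G * ((- 1) ^ k * of_nat (m choose k) * of_real (beta_moment m k)) / of_real (beta_moment m 0)"
      using gbinomial_mult_beta_moment[of k m] B0 by (simp add: G_def eq_divide_eq)
    have sgn: "(1 - z) ^ k = (- 1) ^ k * (z - 1) ^ k" by (simp flip: power_mult_distrib)
    show "G / (2 ^ m * of_real (beta_moment m 0)) * (of_nat (m choose k) * (1 - z) ^ k * (1 + z) ^ (m - k) * of_real (beta_moment m k))
      = 1 / 2 ^ m * (((2 * of_nat m + 1 / 2) gchoose (m - k)) * ((- 1 / 2) gchoose k) * (z - 1) ^ k * (z + 1) ^ (m - k))"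
      unfolding k sgn by (simp add: mult_ac add.commute)
  qed
  also have "\<dots> = jacobi_P m z"
    unfolding jacobi_P_def by (simp add: atMost_atLeast0)
  finally show ?thesis by simp
qed

section \<open>Rate of convergence at the scale of the local variable\<close>

lemma norm_power_diff_le:
  fixes a b :: complex
  assumes "norm a \<le> Q" "norm b \<le> Q"
  shows "norm (a ^ Suc n - b ^ Suc n) \<le> real (Suc n) * norm (a - b) * Q ^ n"
proof -
  have Q: "Q \<ge> 0" using assms norm_ge_zero order_trans by blast
  have "norm (\<Sum>p<Suc n. a ^ p * b ^ (n - p)) \<le> (\<Sum>p<Suc n. Q ^ n)"
  proof (rule sum_norm_le)
    fix p assume "p \<in> {..<Suc n}"
    then have n: "n = p + (n - p)" by simp
    have "norm (a ^ p * b ^ (n - p)) \<le> Q ^ p * Q ^ (n - p)"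
      unfolding norm_mult norm_power using assms Q by (intro mult_mono power_mono) auto
    also have "\<dots> = Q ^ n" by (simp add: n[symmetric] flip: power_add)
    finally show "norm (a ^ p * b ^ (n - p)) \<le> Q ^ n" .
  qed
  then have "norm (\<Sum>p<Suc n. a ^ p * b ^ (n - p)) \<le> real (Suc n) * Q ^ n" by simp
  then have "norm (a - b) * norm (\<Sum>p<Suc n. a ^ p * b ^ (n - p)) \<le> norm (a - b) * (real (Suc n) * Q ^ n)"
    by (intro mult_left_mono) auto
  then show ?thesis
    unfolding power_diff_sumr2 norm_mult by (simp add: mult_ac)
qed

text \<open>An integrable majorant for the error at the scaled point \<open>x\<close>. In the notation of the
next lemma, the first summand comes from replacing \<open>A\<close> by \<open>1 - u\<close>, the second from replacing \<open>1 - u\<close> by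
\<open>exp (- u)\<close>, and the last from the tail \<open>x > N\<close>, where \<open>1 \<le> x ^ 2 / N ^ 2\<close>. Half of the quartic decay of the limit is kept,
because an \<open>(m - 1)\<close>-st power has to be bounded with \<open>(m - 1) / m \<ge> 1 / 2\<close>.\<close>

definition laplace_error :: "real \<Rightarrow> real \<Rightarrow> real" where
  "laplace_error R x = (2 * R * x\<^sup>2 * (R + x\<^sup>2) + exp 2 * (2 * R * x\<^sup>2 + x ^ 4)\<^sup>2 + x\<^sup>2) * exp (2 * R * x\<^sup>2 - 1/4 * x ^ 4)"

lemma laplace_error_decay: "exp_decay (laplace_error R)"
proof -
  let ?E = "\<lambda>n x. x ^ n * exp (2 * R * x\<^sup>2 - 1/4 * x ^ 4)"
  have "laplace_error R = (\<lambda>x. (2 * R\<^sup>2 + 1) * ?E 2 x + ((2 * R + 4 * R\<^sup>2 * exp 2) * ?E 4 x + (4 * R * exp 2 * ?E 6 x + exp 2 * ?E 8 x)))"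
    unfolding laplace_error_def by (rule ext) (simp add: algebra_simps eval_nat_numeral)
  moreover have "exp_decay (?E n)" for n by (rule quartic_exp_decay) simp
  ultimately show ?thesis by (simp only:) (intro exp_decay_add exp_decay_mult)
qed

text \<open>With \<open>y = (x / N) ^ 2\<close> the base of the power on the left is \<open>A = 1 - u + O(\<bar>z\<bar> * y * (\<bar>z\<bar> + y))\<close> for
\<open>u = 2 * z * y + y ^ 2\<close>, and \<open>m * u = x ^ 4 / 2 + \<zeta> * x ^ 2\<close>. So \<open>A\<close> is close to \<open>exp (- u)\<close>, whose
\<open>m\<close>-th power is the integrand of \<open>E\<close>. Both numbers are bounded by \<open>Q = exp (4 * r * y - y ^ 2)\<close>, so the
difference of the \<open>m\<close>-th powers is at most \<open>m * norm (A - exp (- u)) * Q ^ (m - 1)\<close>.\<close>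

lemma scaled_jacobi_integrand_close:
  fixes N x R :: real and m :: nat and \<zeta> :: complex
  assumes N: "N ^ 4 = 2 * real m" "N \<ge> 1" and m: "m \<ge> 2" and x: "0 \<le> x" "x \<le> N"
    and \<zeta>: "norm \<zeta> \<le> R" and R: "2 * R \<le> N\<^sup>2"
  defines "z \<equiv> \<zeta> / of_real (N\<^sup>2)"
  shows "norm (((1 - of_real (x / N) ^ 2) * (1 + (1 - z) / (1 + z) * of_real (x / N) ^ 2)) ^ m
      - quartic_laplace_integrand 0 \<zeta> x)
    \<le> 1 / N\<^sup>2 * ((2 * R * x\<^sup>2 * (R + x\<^sup>2) + exp 2 * (2 * R * x\<^sup>2 + x ^ 4)\<^sup>2) * exp (2 * R * x\<^sup>2 - 1/4 * x ^ 4))"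
proof -
  define y where "y = (x / N)\<^sup>2"
  define Y where "Y = complex_of_real y"
  define r where "r = R / N\<^sup>2"
  have N0: "N > 0" using N by simp
  have R0: "R \<ge> 0" using \<zeta> norm_ge_zero order_trans by blast
  have y: "0 \<le> y" "y \<le> 1" using x N0 by (auto simp: y_def power_le_one)
  have x2: "x\<^sup>2 = N\<^sup>2 * y" using N0 by (simp add: y_def power_divide)
  have N4: "(N\<^sup>2)\<^sup>2 = 2 * real m" using N by (simp flip: power_mult)
  have x4: "x ^ 4 = (N\<^sup>2)\<^sup>2 * y\<^sup>2" unfolding power_mult_distrib[symmetric] x2[symmetric] by (simp flip: power_mult)
  have RN: "R = N\<^sup>2 * r" using N0 by (simp add: r_def)
  have r: "0 \<le> r" "r \<le> 1 / 2" using R R0 N0 by (auto simp: r_def divide_le_eq)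
  have z: "norm z \<le> r" using \<zeta> N0 by (simp add: z_def r_def norm_divide norm_power divide_right_mono)
  have z1: "norm (1 + z) \<ge> 1 / 2" using norm_triangle_ineq4[of "1 + z" z] z r by simp
  then have z1': "1 + z \<noteq> 0" by auto
  define A where "A = (1 - Y) * (1 + (1 - z) / (1 + z) * Y)"
  define u where "u = 2 * z * Y + Y\<^sup>2"
  define Q where "Q = exp (4 * r * y - y\<^sup>2)"
  have "norm (2 * z / (1 + z)) \<le> 4 * r"
  proof -
    have "2 * norm z \<le> 4 * r * norm (1 + z)"
      using mult_left_mono[OF z1, of "4 * r"] z r by simp
    then show ?thesis using z1' by (simp add: norm_divide norm_mult divide_le_eq)
  qed
  note a = this
  have A: "A = (1 - Y\<^sup>2) - 2 * z / (1 + z) * (Y * (1 - Y))"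
    using z1' by (simp add: A_def field_simps power2_eq_square)
  have nY: "norm Y = y" "norm (1 - Y) \<le> 1" "norm (1 - Y\<^sup>2) = 1 - y\<^sup>2"
  proof -
    show "norm Y = y" using y by (simp add: Y_def)
    have "norm (1 - Y) = \<bar>1 - y\<bar>" unfolding Y_def by (metis norm_of_real of_real_1 of_real_diff)
    then show "norm (1 - Y) \<le> 1" using y by simp
    have "norm (1 - Y\<^sup>2) = \<bar>1 - y\<^sup>2\<bar>" unfolding Y_def by (metis norm_of_real of_real_1 of_real_diff of_real_power)
    then show "norm (1 - Y\<^sup>2) = 1 - y\<^sup>2" using y by (simp add: power_le_one)
  qed
  have "norm A \<le> norm (1 - Y\<^sup>2) + norm (2 * z / (1 + z) * (Y * (1 - Y)))"
    unfolding A by (rule norm_triangle_ineq4)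
  also have "norm (2 * z / (1 + z) * (Y * (1 - Y))) \<le> 4 * r * (y * 1)"
    unfolding norm_mult[of "2 * z / (1 + z)"] norm_mult[of Y] using a nY y r by (intro mult_mono) auto
  also have "norm (1 - Y\<^sup>2) + 4 * r * (y * 1) = 1 + (4 * r * y - y\<^sup>2)" by (simp add: nY)
  also have "\<dots> \<le> Q" unfolding Q_def by (rule exp_ge_add_one_self)
  finally have AQ: "norm A \<le> Q" by simp
  have BQ: "norm (exp (- u)) \<le> Q"
  proof -
    have "Re u = 2 * y * Re z + y\<^sup>2" by (simp add: u_def Y_def power2_eq_square)
    moreover have "- (y * Re z) \<le> y * r" 
      using mult_left_mono[of "- Re z" r y] abs_Re_le_cmod[of z] z y by auto
    moreover have "0 \<le> r * y" using r y by simp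
    ultimately show ?thesis unfolding Q_def by (simp add: mult_ac)
  qed
  have u: "norm u \<le> 2 * r * y + y\<^sup>2"
  proof -
    have "norm u \<le> norm (2 * z * Y) + norm (Y\<^sup>2)" unfolding u_def by (rule norm_triangle_ineq)
    also have "\<dots> = 2 * norm z * y + y\<^sup>2" by (simp add: norm_mult norm_power nY)
    also have "\<dots> \<le> 2 * r * y + y\<^sup>2" using z y by (intro add_mono mult_right_mono mult_left_mono) auto
    finally show ?thesis .
  qed
  have AB: "norm (A - exp (- u)) \<le> 4 * r * y * (r + y) + exp 2 * (2 * r * y + y\<^sup>2)\<^sup>2"
  proof -
    have "A - exp (- u) = 2 * z / (1 + z) * (Y * (z + Y)) - (exp (- u) - 1 + u)"
    proof -
      have "2 * z * Y = 2 * z / (1 + z) * (Y * (1 + z))" using z1' by simp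
      have alg: "1 - u + w * (Y * (1 + z)) - w * (Y * (1 - Y)) = 1 - u + w * (Y * (z + Y))" for w
        by (simp add: algebra_simps)
      have "A = 1 - u + 2 * z / (1 + z) * (Y * (1 + z)) - 2 * z / (1 + z) * (Y * (1 - Y))"
        unfolding A u_def using \<open>2 * z * Y = _\<close> by simp
      also have "\<dots> = 1 - u + 2 * z / (1 + z) * (Y * (z + Y))" by (rule alg)
      finally show ?thesis by simp
    qed
    then have "norm (A - exp (- u)) \<le> norm (2 * z / (1 + z) * (Y * (z + Y))) + norm (exp (- u) - 1 + u)"
      by (simp only: norm_triangle_ineq4)
    also have "norm (2 * z / (1 + z) * (Y * (z + Y))) \<le> 4 * r * (y * (r + y))"
    proof -
      have "norm (z + Y) \<le> r + y" using norm_triangle_ineq[of z Y] z nY by simp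
      then show ?thesis
        unfolding norm_mult[of "2 * z / (1 + z)"] norm_mult[of Y] using a nY y r by (intro mult_mono) auto
    qed
    also have "norm (exp (- u) - 1 + u) \<le> exp (norm u) * (norm u)\<^sup>2" by (rule norm_exp_minus_linear_le)
    also have "\<dots> \<le> exp 2 * (2 * r * y + y\<^sup>2)\<^sup>2"
    proof (intro mult_mono power_mono)
      have "2 * r * y + y\<^sup>2 \<le> 1 * 1 + 1"
        using r y by (intro add_mono mult_mono) (auto simp: power_le_one)
      then show "exp (norm u) \<le> exp 2" using u by simp
    qed (use u in auto)
    finally show ?thesis by (simp add: mult.assoc)
  qed
  obtain n where n: "m = Suc n" using m by (cases m) auto
  have "norm (A ^ m - exp (- u) ^ m) \<le> real m * norm (A - exp (- u)) * Q ^ n"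
    unfolding n by (rule norm_power_diff_le[OF AQ BQ])
  also have "\<dots> \<le> real m * (4 * r * y * (r + y) + exp 2 * (2 * r * y + y\<^sup>2)\<^sup>2) * exp (2 * R * x\<^sup>2 - 1/4 * x ^ 4)"
  proof (intro mult_mono AB)
    have "Q ^ n = exp (real n * (4 * r * y - y\<^sup>2))" by (simp add: Q_def exp_of_nat_mult)
    also have "\<dots> \<le> exp (2 * R * x\<^sup>2 - 1/4 * x ^ 4)"
    proof -
      have "real n * (4 * r * y) \<le> real m * (4 * r * y)" using r y by (intro mult_right_mono) (auto simp: n)
      also have "\<dots> = 2 * R * x\<^sup>2"
      proof -
        have "2 * R * x\<^sup>2 = 2 * r * y * (N\<^sup>2)\<^sup>2" unfolding RN x2 by (simp add: power2_eq_square)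
        then show ?thesis unfolding N4 by simp
      qed
      finally have 1: "real n * (4 * r * y) \<le> 2 * R * x\<^sup>2" .
      have "1/4 * x ^ 4 = real m / 2 * y\<^sup>2" unfolding x4 N4 by simp
      also have "\<dots> \<le> real n * y\<^sup>2" using m by (intro mult_right_mono) (auto simp: n)
      finally have "real n * (4 * r * y) - real n * y\<^sup>2 \<le> 2 * R * x\<^sup>2 - 1/4 * x ^ 4" using 1 by linarith
      then show ?thesis by (simp only: right_diff_distrib exp_le_cancel_iff)
    qed
    finally show "Q ^ n \<le> exp (2 * R * x\<^sup>2 - 1/4 * x ^ 4)" .
  qed (use r y in \<open>auto simp: Q_def\<close>)
  also have "real m * (4 * r * y * (r + y) + exp 2 * (2 * r * y + y\<^sup>2)\<^sup>2)
    \<le> 1 / N\<^sup>2 * (2 * R * x\<^sup>2 * (R + x\<^sup>2) + exp 2 * (2 * R * x\<^sup>2 + x ^ 4)\<^sup>2)"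
  proof -
    have mm: "real m = (N\<^sup>2)\<^sup>2 / 2" using N4 by simp
    define M where "M = N\<^sup>2"
    have M: "M \<ge> 1" using N by (simp add: M_def)
    have 1: "real m * (4 * r * y * (r + y)) = 1 / M * (2 * R * x\<^sup>2 * (R + x\<^sup>2))"
      unfolding mm RN x2 M_def[symmetric] using M by (simp add: field_simps power2_eq_square)
    have 2: "2 * R * x\<^sup>2 + x ^ 4 = M\<^sup>2 * (2 * r * y + y\<^sup>2)"
      unfolding x4 RN x2 M_def[symmetric] by (simp add: algebra_simps power2_eq_square)
    have "real m * (2 * r * y + y\<^sup>2)\<^sup>2 = 1 / (2 * M\<^sup>2) * (2 * R * x\<^sup>2 + x ^ 4)\<^sup>2"
      unfolding 2 mm M_def[symmetric] using M by (simp add: field_simps power2_eq_square)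
    also have "\<dots> \<le> 1 / M * (2 * R * x\<^sup>2 + x ^ 4)\<^sup>2"
    proof (rule mult_right_mono)
      have "M * 1 \<le> M * (2 * M)" using M by (intro mult_left_mono) auto
      then show "1 / (2 * M\<^sup>2) \<le> 1 / M" using M by (simp add: field_simps power2_eq_square)
    qed simp
    finally have 3: "exp 2 * (real m * (2 * r * y + y\<^sup>2)\<^sup>2) \<le> exp 2 * (1 / M * (2 * R * x\<^sup>2 + x ^ 4)\<^sup>2)"
      by (intro mult_left_mono) auto
    have "real m * (4 * r * y * (r + y) + exp 2 * (2 * r * y + y\<^sup>2)\<^sup>2) = real m * (4 * r * y * (r + y)) + exp 2 * (real m * (2 * r * y + y\<^sup>2)\<^sup>2)"
      by (simp add: distrib_left mult.left_commute)
    also have "\<dots> \<le> 1 / M * (2 * R * x\<^sup>2 * (R + x\<^sup>2)) + exp 2 * (1 / M * (2 * R * x\<^sup>2 + x ^ 4)\<^sup>2)"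
      using 1 3 by simp
    also have "\<dots> = 1 / M * (2 * R * x\<^sup>2 * (R + x\<^sup>2) + exp 2 * (2 * R * x\<^sup>2 + x ^ 4)\<^sup>2)"
      by (simp add: distrib_left mult.left_commute)
    finally show ?thesis unfolding M_def .
  qed
  finally have "norm (A ^ m - exp (- u) ^ m) \<le> 1 / N\<^sup>2 * (2 * R * x\<^sup>2 * (R + x\<^sup>2) + exp 2 * (2 * R * x\<^sup>2 + x ^ 4)\<^sup>2) * exp (2 * R * x\<^sup>2 - 1/4 * x ^ 4)"
    by simp
  moreover have "A = (1 - of_real (x / N) ^ 2) * (1 + (1 - z) / (1 + z) * of_real (x / N) ^ 2)"
    by (simp add: A_def Y_def y_def)
  moreover have "exp (- u) ^ m = quartic_laplace_integrand 0 \<zeta> x"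
  proof -
    have "of_nat m * u = of_real ((N\<^sup>2)\<^sup>2) / 2 * u" unfolding N4 by simp
    also have "\<dots> = of_real (x ^ 4) / 2 + \<zeta> * of_real (x\<^sup>2)"
    proof -
      have "\<zeta> = z * of_real (N\<^sup>2)" using N0 by (simp add: z_def)
      then show ?thesis unfolding x4 x2 u_def Y_def
        by (simp add: algebra_simps power2_eq_square)
    qed
    finally have mu: "of_nat m * u = of_real (x ^ 4) / 2 + \<zeta> * of_real (x\<^sup>2)" .
    have "exp (- u) ^ m = exp (- (of_nat m * u))" by (simp flip: exp_of_nat_mult)
    also have "\<dots> = quartic_laplace_integrand 0 \<zeta> x"
      unfolding mu by (simp add: quartic_laplace_integrand_def)
    finally show ?thesis .
  qed
  ultimately show ?thesis by (simp only: mult.assoc)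
qed

text \<open>The substitution \<open>s = x / N\<close> stretches \<open>{0..1}\<close> to \<open>{0..N}\<close>. The integrand, extended by \<open>0\<close> to the
half-line, is compared pointwise with that of \<open>E\<close>.\<close>

lemma jacobi_integral_close:
  fixes N R :: real and m :: nat and \<zeta> :: complex
  assumes N: "N ^ 4 = 2 * real m" "N \<ge> 1" and m: "m \<ge> 2"
    and \<zeta>: "norm \<zeta> \<le> R" and R: "2 * R \<le> N\<^sup>2"
  shows "norm (of_real N * jacobi_integral m (\<zeta> / of_real (N\<^sup>2)) - quartic_laplace 0 \<zeta>)
    \<le> integral {0..} (laplace_error R) / N\<^sup>2"
proof -
  define z where "z = \<zeta> / of_real (N\<^sup>2)"
  define f where "f s = ((1 - of_real s ^ 2) * (1 + (1 - z) / (1 + z) * of_real s ^ 2)) ^ m" for s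
  have R0: "R \<ge> 0" using \<zeta> norm_ge_zero order_trans by blast
  have "f integrable_on {0..1}"
    unfolding f_def by (intro integrable_continuous_real continuous_intros)
  then have "(f has_integral jacobi_integral m z) {0..1}"
    unfolding jacobi_integral_def f_def[symmetric] by (rule integrable_integral)
  from has_integral_stretch_real[OF this, of "1 / N"]
  have "((\<lambda>x. f (1 / N * x)) has_integral of_real N * jacobi_integral m z) ((\<lambda>x. x / (1 / N)) ` {0..1})"
    using N by (simp add: scaleR_conv_of_real)
  also have "(\<lambda>x. x / (1 / N)) ` {0..1} = {0..N}"
    using N image_mult_atLeastAtMost[of N 0 1] by (simp add: mult.commute)
  finally have "((\<lambda>x. if x \<in> {0..N} then f (1 / N * x) else 0) has_integral of_real N * jacobi_integral m z) {0..}"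
    by (subst has_integral_restrict) auto
  note T = this
  have "((quartic_laplace_integrand 0 \<zeta>) has_integral quartic_laplace 0 \<zeta>) {0..}"
    unfolding quartic_laplace_def by (intro integrable_integral exp_decay_integrable quartic_laplace_integrand_decay)
  note D = has_integral_diff[OF T this]
  have "norm (integral {0..} (\<lambda>x. (if x \<in> {0..N} then f (1 / N * x) else 0) - quartic_laplace_integrand 0 \<zeta> x))
     \<le> integral {0..} (\<lambda>x. 1 / N\<^sup>2 * laplace_error R x)"
  proof (rule integral_norm_bound_integral)
    show "(\<lambda>x. (if x \<in> {0..N} then f (1 / N * x) else 0) - quartic_laplace_integrand 0 \<zeta> x) integrable_on {0..}"
      using D by blast
    show "(\<lambda>x. 1 / N\<^sup>2 * laplace_error R x) integrable_on {0..}"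
      by (intro integrable_on_mult_right exp_decay_integrable laplace_error_decay)
    fix x :: real assume "x \<in> {0..}"
    then have x: "x \<ge> 0" by simp
    show "norm ((if x \<in> {0..N} then f (1 / N * x) else 0) - quartic_laplace_integrand 0 \<zeta> x) \<le> 1 / N\<^sup>2 * laplace_error R x"
    proof (cases "x \<le> N")
      case True
      then have "norm ((if x \<in> {0..N} then f (1 / N * x) else 0) - quartic_laplace_integrand 0 \<zeta> x)
        \<le> 1 / N\<^sup>2 * ((2 * R * x\<^sup>2 * (R + x\<^sup>2) + exp 2 * (2 * R * x\<^sup>2 + x ^ 4)\<^sup>2) * exp (2 * R * x\<^sup>2 - 1/4 * x ^ 4))"
        using scaled_jacobi_integrand_close[OF N m x True \<zeta> R] x unfolding f_def z_def by simp
      also have "\<dots> \<le> 1 / N\<^sup>2 * laplace_error R x"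
        unfolding laplace_error_def by (intro mult_left_mono mult_right_mono) auto
      finally show ?thesis .
    next
      case False
      have "norm (quartic_laplace_integrand 0 \<zeta> x) = exp (- (x ^ 4 / 2) - Re \<zeta> * x\<^sup>2)"
        by (simp add: norm_quartic_laplace_integrand)
      also have "\<dots> \<le> exp (2 * R * x\<^sup>2 - 1/4 * x ^ 4)"
      proof -
        have "- Re \<zeta> * x\<^sup>2 \<le> 2 * R * x\<^sup>2"
          using abs_Re_le_cmod[of \<zeta>] \<zeta> R0 by (intro mult_right_mono) auto
        moreover have "x ^ 4 \<ge> 0" by simp
        ultimately have "- (x ^ 4 / 2) - Re \<zeta> * x\<^sup>2 \<le> 2 * R * x\<^sup>2 - 1/4 * x ^ 4" by linarith
        then show ?thesis by (simp only: exp_le_cancel_iff)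
      qed
      also have "\<dots> = 1 * exp (2 * R * x\<^sup>2 - 1/4 * x ^ 4)" by simp
      also have "\<dots> \<le> (1 / N\<^sup>2 * x\<^sup>2) * exp (2 * R * x\<^sup>2 - 1/4 * x ^ 4)"
      proof (intro mult_right_mono)
        have "N\<^sup>2 \<le> x\<^sup>2" using False N by (intro power_mono) auto
        then show "1 \<le> 1 / N\<^sup>2 * x\<^sup>2" using N by (simp add: pos_le_divide_eq)
      qed simp
      also have "\<dots> \<le> 1 / N\<^sup>2 * laplace_error R x"
        unfolding laplace_error_def mult.assoc[of "1 / N\<^sup>2"] using R0
        by (intro mult_left_mono mult_right_mono) auto
      finally show ?thesis using False by simp
    qed
  qed
  then show ?thesis using integral_unique[OF D] by (simp add: z_def)
qed

section \<open>Transfer of zeros\<close>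

text \<open>By the minimum principle: on the boundary circle \<open>norm g\<close> exceeds \<open>c * s / 2\<close>, at the centre it is
smaller.\<close>

lemma holomorphic_zero_near_approximate_zero:
  assumes holo: "g holomorphic_on cball z0 s" and s: "0 < s"
    and f0: "f z0 = 0" and low: "\<And>z. z \<in> cball z0 s \<Longrightarrow> c * norm (z - z0) \<le> norm (f z)"
    and close: "\<And>z. z \<in> cball z0 s \<Longrightarrow> norm (g z - f z) < c * s / 2"
  obtains z where "z \<in> ball z0 s" "g z = 0"
proof (rule holomorphic_contract_to_zero[of z0 s g])
  show "continuous_on (cball z0 s) g" using holo by (rule holomorphic_on_imp_continuous_on)
  show "g holomorphic_on ball z0 s" using holo by (rule holomorphic_on_subset) auto
  fix z assume z: "norm (z0 - z) = s"
  have "norm (g z0) < c * s / 2" using close[of z0] s f0 by simp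
  moreover have "c * s \<le> norm (f z)" using low[of z] z by (simp add: dist_norm norm_minus_commute)
  moreover have "norm (f z) - norm (g z) \<le> norm (g z - f z)"
    by (subst norm_minus_commute) (rule norm_triangle_ineq2)
  moreover have "norm (g z - f z) < c * s / 2" using close[of z] z by (simp add: dist_norm)
  ultimately show "norm (g z0) < norm (g z)" by linarith
qed (use s in auto)

lemma linear_lower_bound_at_simple_zero:
  fixes f :: "complex \<Rightarrow> complex"
  assumes "(f has_field_derivative d) (at z0)" "d \<noteq> 0" "f z0 = 0"
  obtains r where "r > 0" "\<And>z. norm (z - z0) < r \<Longrightarrow> norm d / 2 * norm (z - z0) \<le> norm (f z)"
proof -
  have "(f has_derivative (*) d) (at z0)" using assms by (simp add: has_field_derivative_def)
  then obtain r where r: "r > 0" "\<And>z. norm (z - z0) < r \<Longrightarrow> norm (f z - f z0 - d * (z - z0)) \<le> norm d / 2 * norm (z - z0)"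
    using assms(2) unfolding has_derivative_at_alt by (metis half_gt_zero zero_less_norm_iff)
  show ?thesis
  proof (rule that[OF r(1)])
    fix z assume "norm (z - z0) < r"
    from r(2)[OF this] have "norm (f z - d * (z - z0)) \<le> norm d / 2 * norm (z - z0)" by (simp add: assms)
    moreover have "norm (d * (z - z0)) - norm (f z) \<le> norm (f z - d * (z - z0))"
      by (subst norm_minus_commute) (rule norm_triangle_ineq2)
    ultimately show "norm d / 2 * norm (z - z0) \<le> norm (f z)" by (simp add: norm_mult)
  qed
qed

text \<open>Away from \<open>z = - 1\<close> the integral is a polynomial divided by \<open>(1 + z) ^ m\<close>.\<close>

lemma jacobi_integral_holomorphic:
  assumes "S \<subseteq> {z. 1 + z \<noteq> 0}"
  shows "jacobi_integral m holomorphic_on S"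
proof -
  have "(\<lambda>z. jacobi_P m z / (jacobi_coeff m * (1 + z) ^ m)) holomorphic_on S"
    unfolding jacobi_P_def using assms jacobi_coeff_nonzero[of m] by (intro holomorphic_intros) auto
  then show ?thesis
    by (rule holomorphic_transform) (use assms jacobi_coeff_nonzero[of m] jacobi_P_eq_integral in auto)
qed

text \<open>At a double zero both initial values of \<open>weber_D\<close> would vanish, so \<open>weber_D\<close> would be identically \<open>0\<close>.\<close>

lemma quartic_laplace_simple_zero:
  assumes "quartic_laplace 0 \<zeta> = 0"
  shows "quartic_laplace 1 \<zeta> \<noteq> 0"
proof
  assume "quartic_laplace 1 \<zeta> = 0"
  then have "weber_D \<zeta> = 0" "weber_D' \<zeta> = 0" using assms by (simp_all add: weber_D_def weber_D'_def)
  then have "weber_D 0 = 0" by (rule weber_solution_unique[OF weber_solution_weber_D])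
  then show False using weber_D_0 by blast
qed

text \<open>Near a zero of \<open>E\<close> with derivative \<open>d\<close> one has \<open>norm (E \<zeta>) \<ge> norm d / 2 * norm (\<zeta> - \<zeta>0)\<close>, whereas the
rescaled Jacobi integral differs from \<open>E\<close> by at most \<open>K / sqrt (2 * m)\<close>. On a circle of radius
\<open>C / sqrt (2 * m)\<close> with \<open>C = 8 * K / norm d\<close> the former is at least four times the latter.\<close>

lemma jacobi_zero_near_weber_zero:
  assumes "weber_D \<zeta>0 = 0"
  obtains C M where "C > 0"
    "\<And>m. m \<ge> M \<Longrightarrow> \<exists>\<zeta>. norm (\<zeta> - \<zeta>0) \<le> C / sqrt (2 * real m) \<and> jacobi_P m (\<zeta> / of_real (sqrt (2 * real m))) = 0"
proof -
  have f0: "quartic_laplace 0 \<zeta>0 = 0" using assms by (simp add: weber_D_def)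
  define d where "d = - quartic_laplace 1 \<zeta>0"
  have d: "d \<noteq> 0" using quartic_laplace_simple_zero[OF f0] by (simp add: d_def)
  have "(quartic_laplace 0 has_field_derivative d) (at \<zeta>0)"
    using has_field_derivative_quartic_laplace[of 0 \<zeta>0] by (simp add: d_def)
  from linear_lower_bound_at_simple_zero[OF this d f0] obtain r
    where r: "r > 0" and low: "\<And>z. norm (z - \<zeta>0) < r \<Longrightarrow> norm d / 2 * norm (z - \<zeta>0) \<le> norm (quartic_laplace 0 z)"
    by blast
  define R where "R = norm \<zeta>0 + r"
  define K where "K = max 1 (integral {0..} (laplace_error R))"
  define C where "C = 8 * K / norm d"
  have K: "K > 0" by (simp add: K_def)
  have C: "C > 0" using K d by (simp add: C_def)
  have "filterlim (\<lambda>m. sqrt (2 * real m)) at_top sequentially" by real_asymp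
  then have "\<forall>\<^sub>F m in sequentially. sqrt (2 * real m) > max (max 1 (2 * R)) (C / r)"
    unfolding filterlim_at_top_dense by blast
  then have "\<forall>\<^sub>F m in sequentially. m \<ge> 2 \<and> sqrt (2 * real m) > max (max 1 (2 * R)) (C / r)"
    using eventually_ge_at_top[of 2] by (intro eventually_conj)
  then obtain M where M: "\<And>m. m \<ge> M \<Longrightarrow> m \<ge> 2 \<and> sqrt (2 * real m) > max (max 1 (2 * R)) (C / r)"
    by (auto simp: eventually_sequentially)
  show ?thesis
  proof (rule that[OF C])
    fix m assume "m \<ge> M"
    define T where "T = sqrt (2 * real m)"
    define N where "N = sqrt T"
    have m: "m \<ge> 2" and T: "T > 1" "T > 2 * R" "T > C / r" using M[OF \<open>m \<ge> M\<close>] by (auto simp: T_def)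
    have N2: "N\<^sup>2 = T" using T by (simp add: N_def)
    have "N ^ 4 = (N\<^sup>2)\<^sup>2" by (simp flip: power_mult)
    then have N4: "N ^ 4 = 2 * real m" unfolding N2 by (simp add: T_def)
    have N1: "N \<ge> 1" using T by (simp add: N_def)
    define s where "s = C / T"
    have s: "s > 0" using C T by (simp add: s_def)
    have sr: "s < r" using T r C by (simp add: s_def field_simps)
    have R0: "R > 0" using r by (simp add: R_def add_nonneg_pos)
    have nz: "1 + z / of_real T \<noteq> 0" if "norm z \<le> R" for z :: complex
    proof
      assume "1 + z / of_real T = 0"
      then have "z / of_real T = - 1" by (simp add: add_eq_0_iff)
      then have "norm (z / of_real T) = 1" by simp
      then show False using that T R0 by (simp add: norm_divide)
    qed
    have ball: "norm z \<le> R" "norm (z - \<zeta>0) < r" if "z \<in> cball \<zeta>0 s" for z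
      using that sr norm_triangle_ineq2[of z \<zeta>0] by (auto simp: R_def dist_norm norm_minus_commute)
    obtain \<zeta> where \<zeta>: "\<zeta> \<in> ball \<zeta>0 s" "of_real N * jacobi_integral m (\<zeta> / of_real T) = 0"
    proof (rule holomorphic_zero_near_approximate_zero[where f = "quartic_laplace 0" and c = "norm d / 2"
            and g = "\<lambda>z. of_real N * jacobi_integral m (z / of_real T)" and ?z0.0 = \<zeta>0 and s = s])
      have "(jacobi_integral m \<circ> (\<lambda>z. z / of_real T)) holomorphic_on cball \<zeta>0 s"
        using T nz ball(1) by (intro holomorphic_on_compose jacobi_integral_holomorphic holomorphic_intros) auto
      then show "(\<lambda>z. of_real N * jacobi_integral m (z / of_real T)) holomorphic_on cball \<zeta>0 s"
        unfolding o_def by (intro holomorphic_intros)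
      show "norm d / 2 * norm (z - \<zeta>0) \<le> norm (quartic_laplace 0 z)" if "z \<in> cball \<zeta>0 s" for z
        using low ball(2)[OF that] by blast
      fix z assume z: "z \<in> cball \<zeta>0 s"
      have "norm (of_real N * jacobi_integral m (z / of_real T) - quartic_laplace 0 z) \<le> integral {0..} (laplace_error R) / T"
        using jacobi_integral_close[OF N4 N1 m ball(1)[OF z]] T unfolding N2 by simp
      also have "\<dots> \<le> K / T" using T by (intro divide_right_mono) (auto simp: K_def)
      also have "\<dots> < 2 * K / T" using K T by (simp add: divide_strict_right_mono)
      also have "\<dots> = norm d / 2 * s / 2" using d by (simp add: s_def C_def)
      finally show "norm (of_real N * jacobi_integral m (z / of_real T) - quartic_laplace 0 z) < norm d / 2 * s / 2" .
    qed (use s f0 that in auto)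
    have "\<zeta> \<in> cball \<zeta>0 s" using \<zeta> by auto
    then have "jacobi_P m (\<zeta> / of_real T) = 0"
      using \<zeta>(2) N1 jacobi_P_eq_integral[OF nz[OF ball(1)]] by auto
    moreover have "norm (\<zeta> - \<zeta>0) \<le> C / T" using \<zeta>(1) by (simp add: s_def dist_norm norm_minus_commute)
    ultimately show "\<exists>\<zeta>. norm (\<zeta> - \<zeta>0) \<le> C / sqrt (2 * real m) \<and> jacobi_P m (\<zeta> / of_real (sqrt (2 * real m))) = 0"
      unfolding T_def by blast
  qed
qed

section \<open>The local chart and the zeros in its coordinate\<close>

text \<open>Near \<open>0\<close> the series under the root is within distance \<open>1\<close> of its value \<open>1\<close> at the origin, hence off the
branch cut of the principal root.\<close>

lemma tau_holomorphic_near_0: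
  obtains \<rho> where "\<rho> > 0" "tau holomorphic_on ball 0 \<rho>" "tau 0 = 1"
proof -
  define S where "S w = (\<Sum>k. w ^ k / (of_nat k + 1))" for w :: complex
  have sums: "(\<lambda>k. 1 / (of_nat k + 1) * (w - 0) ^ k) sums S w" if "w \<in> ball 0 1" for w :: complex
  proof -
    have "summable (\<lambda>k. w ^ k / (of_nat k + 1))"
    proof (rule summable_comparison_test')
      show "summable (\<lambda>k. norm w ^ k)" using that by (intro summable_geometric) auto
      show "norm (w ^ k / (of_nat k + 1)) \<le> norm w ^ k" for k
      proof -
        have "norm (of_nat k + 1 :: complex) = real k + 1" by (metis norm_of_nat of_nat_Suc add.commute)
        then show ?thesis by (simp add: norm_divide norm_power divide_le_eq mult_left_le mult_le_cancel_left1 algebra_simps)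
      qed
    qed
    then show ?thesis unfolding S_def by (simp add: summable_sums)
  qed
  have holoS: "S holomorphic_on ball 0 1" by (rule power_series_holomorphic[OF sums])
  have "(\<lambda>k. 1 / (of_nat k + 1) * (0 - 0) ^ k) sums (1 :: complex)"
    using powser_sums_zero[of "\<lambda>k. 1 / (of_nat k + 1) :: complex"] by simp
  then have S0: "S 0 = 1" using sums[of 0] sums_unique2 by fastforce
  have tau: "tau z = csqrt (S (z\<^sup>2))" for z by (simp add: tau_def S_def power_mult)
  have "continuous (at 0) S"
    using holoS by (intro continuous_on_interior[where S = "ball 0 1"] holomorphic_on_imp_continuous_on) auto
  then obtain \<delta> where \<delta>: "\<delta> > 0" "\<And>w. norm w < \<delta> \<Longrightarrow> norm (S w - 1) < 1"
    unfolding continuous_at_eps_delta S0 by (metis dist_norm diff_zero zero_less_one)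
  define \<rho> where "\<rho> = min 1 \<delta>"
  have sq: "norm (z\<^sup>2) < 1" "norm (z\<^sup>2) < \<delta>" if "z \<in> ball 0 \<rho>" for z :: complex
  proof -
    have z: "norm z < 1" "norm z < \<delta>" using that by (auto simp: \<rho>_def)
    have "norm (z\<^sup>2) \<le> norm z" using z mult_left_le[of "norm z" "norm z"] by (simp add: norm_mult power2_eq_square)
    then show "norm (z\<^sup>2) < 1" "norm (z\<^sup>2) < \<delta>" using z by linarith+
  qed
  have "(\<lambda>z. csqrt ((S \<circ> (\<lambda>z. z\<^sup>2)) z)) holomorphic_on ball 0 \<rho>"
  proof (intro holomorphic_on_csqrt' holomorphic_on_compose holomorphic_intros)
    show "S holomorphic_on (\<lambda>z. z\<^sup>2) ` ball 0 \<rho>"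
      by (rule holomorphic_on_subset[OF holoS]) (use sq in auto)
    fix z :: complex assume "z \<in> ball 0 \<rho>"
    then have "norm (1 - S (z\<^sup>2)) < 1" using \<delta>(2) sq(2) by (simp add: norm_minus_commute)
    then have "Re (1 - S (z\<^sup>2)) < 1" using complex_Re_le_cmod order_le_less_trans by blast
    then have "Re (S (z\<^sup>2)) > 0" by simp
    then show "(S \<circ> (\<lambda>z. z\<^sup>2)) z \<notin> \<real>\<^sub>\<le>\<^sub>0" by (auto simp: complex_nonpos_Reals_iff)
  qed
  moreover have "(\<lambda>z. csqrt ((S \<circ> (\<lambda>z. z\<^sup>2)) z)) = tau" by (simp add: fun_eq_iff tau)
  moreover have "tau 0 = 1" by (simp add: tau S0)
  moreover have "\<rho> > 0" using \<delta> by (simp add: \<rho>_def)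
  ultimately show ?thesis using that by metis
qed

text \<open>Up to a nonzero constant depending on \<open>m\<close>, the map \<open>lam m\<close> is \<open>z * tau z\<close>, whose derivative at \<open>0\<close> is
\<open>1\<close>. A disc on which that function is injective therefore serves all \<open>m\<close> at once.\<close>

lemma local_chart_small:
  obtains \<epsilon>0 L where "\<epsilon>0 > 0" "L > 0" "\<And>\<epsilon>. 0 < \<epsilon> \<Longrightarrow> \<epsilon> < \<epsilon>0 \<Longrightarrow> local_chart \<epsilon>"
    "\<And>z. norm z < \<epsilon>0 \<Longrightarrow> norm (tau z - 1) \<le> L * norm z"
proof -
  obtain \<rho> where \<rho>: "\<rho> > 0" and holo: "tau holomorphic_on ball 0 \<rho>" and tau0: "tau 0 = 1"
    by (rule tau_holomorphic_near_0)
  define h where "h z = z * tau z" for z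
  have dtau: "(tau has_field_derivative deriv tau 0) (at 0)"
    using holo \<rho> by (intro holomorphic_derivI[where S = "ball 0 \<rho>"]) auto
  have "(h has_field_derivative 1 * tau 0 + deriv tau 0 * 0) (at 0)"
    unfolding h_def by (rule DERIV_mult[OF DERIV_ident dtau])
  then have "deriv h 0 = 1" by (simp add: tau0 DERIV_imp_deriv)
  then have dnz: "deriv h 0 \<noteq> 0" by simp
  have holoh: "h holomorphic_on ball 0 \<rho>"
    unfolding h_def by (intro holomorphic_intros holo)
  have "0 \<in> ball (0 :: complex) \<rho>" using \<rho> by simp
  from has_complex_derivative_locally_injective[OF holoh this open_ball dnz]
  obtain r where r: "r > 0" and inj: "inj_on h (ball 0 r)" by blast
  have "(tau has_derivative (*) (deriv tau 0)) (at 0)" using dtau by (simp add: has_field_derivative_def)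
  then obtain d where d: "d > 0" "\<And>z. norm z < d \<Longrightarrow> norm (tau z - 1 - deriv tau 0 * z) \<le> 1 * norm z"
    unfolding has_derivative_at_alt tau0 by (metis diff_zero zero_less_one)
  define \<epsilon>0 where "\<epsilon>0 = min \<rho> (min r d)"
  define L where "L = norm (deriv tau 0) + 1"
  show ?thesis
  proof (rule that[of \<epsilon>0 L])
    show "\<epsilon>0 > 0" "L > 0" using \<rho> r d by (auto simp: \<epsilon>0_def L_def add_nonneg_pos)
    show "norm (tau z - 1) \<le> L * norm z" if "norm z < \<epsilon>0" for z
    proof -
      have "norm (tau z - 1) \<le> norm (tau z - 1 - deriv tau 0 * z) + norm (deriv tau 0 * z)"
        using norm_triangle_ineq[of "tau z - 1 - deriv tau 0 * z" "deriv tau 0 * z"] by simp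
      also have "\<dots> \<le> L * norm z" using d(2)[of z] that by (simp add: L_def norm_mult \<epsilon>0_def algebra_simps)
      finally show ?thesis .
    qed
    fix \<epsilon> :: real assume \<epsilon>: "0 < \<epsilon>" "\<epsilon> < \<epsilon>0"
    have sub: "ball 0 \<epsilon> \<subseteq> ball (0::complex) \<rho>" "ball 0 \<epsilon> \<subseteq> ball (0::complex) r" using \<epsilon> by (auto simp: \<epsilon>0_def)
    show "local_chart \<epsilon>"
      unfolding local_chart_def
    proof (intro conjI allI impI)
      show "tau analytic_on ball 0 \<epsilon>"
        using holomorphic_on_subset[OF holo sub(1)] by (simp add: analytic_on_open)
      fix m :: nat assume m: "1 \<le> m"
      define c where "c = complex_of_real (sqrt (2 * real m)) * exp (- (of_real pi * \<i> / 4))"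
      have c: "c \<noteq> 0" using m by (simp add: c_def)
      have lam: "lam m = (\<lambda>z. c * h z)" by (simp add: fun_eq_iff lam_def c_def h_def mult_ac)
      show H: "lam m holomorphic_on ball 0 \<epsilon>"
        unfolding lam by (intro holomorphic_intros holomorphic_on_subset[OF holoh sub(1)])
      show I: "inj_on (lam m) (ball 0 \<epsilon>)"
        using inj_on_subset[OF inj sub(2)] c by (simp add: lam inj_on_def)
      show "open (lam m ` ball 0 \<epsilon>)" by (rule open_mapping_thm3[OF H _ I]) simp
      obtain g where g: "g holomorphic_on lam m ` ball 0 \<epsilon>" "\<And>z. z \<in> ball 0 \<epsilon> \<Longrightarrow> g (lam m z) = z"
        using holomorphic_has_inverse[OF H open_ball I] by blast
      show "lam_inv \<epsilon> m holomorphic_on lam m ` ball 0 \<epsilon>"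
        by (rule holomorphic_transform[OF g(1)]) (use g(2) I in \<open>auto simp: lam_inv_def\<close>)
    qed
  qed
qed

text \<open>In the variable \<open>\<zeta> = sqrt (2 * m) * z\<close> the chart reads \<open>lam m z = cis (- (pi / 4)) * \<zeta> * tau z\<close>. As
\<open>tau z - 1\<close> is of the order of \<open>z\<close>, that is of \<open>1 / sqrt (2 * m)\<close>, passing from \<open>\<zeta>\<close> to the coordinate
\<open>lam m z\<close> changes distances to the limiting zero only within the error already present.\<close>

lemma jacobi_zero_near_q_ell_zero:
  assumes "q_ell \<xi>s = 0" and L: "L > 0" "\<epsilon> > 0"
    and tau: "\<And>z. norm z < \<epsilon> \<Longrightarrow> norm (tau z - 1) \<le> L * norm z"
  obtains C M where "C > 0"
    "\<And>m. m \<ge> M \<Longrightarrow> \<exists>z\<in>ball 0 \<epsilon>. jacobi_P m z = 0 \<and> norm (\<xi>s - lam m z) \<le> C / sqrt (2 * real m)"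
proof -
  define \<zeta>0 where "\<zeta>0 = cis (pi / 4) * \<xi>s"
  have "weber_D \<zeta>0 = 0" using assms(1) by (simp add: q_ell_eq_weber_D \<zeta>0_def)
  then obtain C M where C: "C > 0"
    and CM: "\<And>m. m \<ge> M \<Longrightarrow> \<exists>\<zeta>. norm (\<zeta> - \<zeta>0) \<le> C / sqrt (2 * real m) \<and> jacobi_P m (\<zeta> / of_real (sqrt (2 * real m))) = 0"
    using jacobi_zero_near_weber_zero by blast
  define R where "R = norm \<zeta>0 + C"
  have R: "R > 0" using C by (simp add: R_def add_nonneg_pos)
  have "filterlim (\<lambda>m. sqrt (2 * real m)) at_top sequentially" by real_asymp
  then have "\<forall>\<^sub>F m in sequentially. sqrt (2 * real m) > max 1 (R / \<epsilon>)"
    unfolding filterlim_at_top_dense by blast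
  then obtain M' where M': "\<And>m. m \<ge> M' \<Longrightarrow> sqrt (2 * real m) > max 1 (R / \<epsilon>)"
    by (auto simp: eventually_sequentially)
  show ?thesis
  proof (rule that[of "C + R * (L * R)" "max M M'"])
    show "C + R * (L * R) > 0" using C R L by (simp add: add_pos_pos)
    fix m assume m: "max M M' \<le> m"
    define T where "T = sqrt (2 * real m)"
    have T: "T > 1" "T > R / \<epsilon>" using M'[of m] m by (auto simp: T_def)
    obtain \<zeta> where \<zeta>: "norm (\<zeta> - \<zeta>0) \<le> C / T" "jacobi_P m (\<zeta> / of_real T) = 0"
      using CM[of m] m unfolding T_def by auto
    define z where "z = \<zeta> / of_real T"
    have "C / T \<le> C" using C T by (simp add: divide_le_eq)
    then have nR: "norm \<zeta> \<le> R" using \<zeta>(1) norm_triangle_ineq2[of \<zeta> \<zeta>0] by (simp add: R_def)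
    then have nz: "norm z \<le> R / T" using T by (simp add: z_def norm_divide divide_right_mono)
    also have "R / T < \<epsilon>" using T assms by (simp add: field_simps)
    finally have z\<epsilon>: "norm z < \<epsilon>" .
    have lam: "lam m z = cis (- (pi / 4)) * (\<zeta> * tau z)"
    proof -
      have "exp (- (of_real pi * \<i> / 4)) = cis (- (pi / 4))" by (simp add: cis_conv_exp mult.commute)
      moreover have "\<zeta> = of_real T * z" using T by (simp add: z_def)
      ultimately show ?thesis by (simp add: lam_def T_def mult_ac)
    qed
    have \<xi>s: "\<xi>s = cis (- (pi / 4)) * \<zeta>0"
      by (simp add: \<zeta>0_def cis_mult flip: mult.assoc)
    have "\<xi>s - lam m z = cis (- (pi / 4)) * (\<zeta>0 - \<zeta> * tau z)"
      unfolding lam \<xi>s by (simp add: right_diff_distrib)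
    then have "norm (\<xi>s - lam m z) = norm (\<zeta>0 - \<zeta> * tau z)" by (simp add: norm_mult)
    also have "\<zeta>0 - \<zeta> * tau z = - (\<zeta> - \<zeta>0) - \<zeta> * (tau z - 1)" by (simp add: algebra_simps)
    also have "norm \<dots> \<le> norm (\<zeta> - \<zeta>0) + norm \<zeta> * norm (tau z - 1)"
      using norm_triangle_ineq4[of "- (\<zeta> - \<zeta>0)" "\<zeta> * (tau z - 1)"] by (simp only: norm_minus_cancel norm_mult)
    also have "\<dots> \<le> C / T + R * (L * (R / T))"
    proof (intro add_mono mult_mono \<zeta>(1) nR)
      have "norm (tau z - 1) \<le> L * norm z" by (rule tau[OF z\<epsilon>])
      also have "\<dots> \<le> L * (R / T)" using nz L by (intro mult_left_mono) auto
      finally show "norm (tau z - 1) \<le> L * (R / T)" .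
    qed (use R in auto)
    also have "\<dots> = (C + R * (L * R)) / T" by (simp add: add_divide_distrib)
    finally show "\<exists>z\<in>ball 0 \<epsilon>. jacobi_P m z = 0 \<and> norm (\<xi>s - lam m z) \<le> (C + R * (L * R)) / sqrt (2 * real m)"
      using z\<epsilon> \<zeta>(2) unfolding T_def[symmetric] z_def[symmetric] by auto
  qed
qed

theorem theorem1p10:
  shows "\<exists>\<epsilon>\<^sub>0>0. \<forall>\<epsilon>. 0 < \<epsilon> \<and> \<epsilon> < \<epsilon>\<^sub>0 \<longrightarrow>
    local_chart \<epsilon> \<and>
    (\<forall>g R \<xi>s. admissible_arc \<epsilon> g \<and> R > 0 \<and>
       q_ell \<xi>s = 0 \<and> cmod \<xi>s < R \<and>
       (\<forall>\<^sub>F m in sequentially. \<xi>s \<in> lam m ` ball 0 \<epsilon> \<and>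
          lam_inv \<epsilon> m \<xi>s \<in> Omega_minus \<epsilon> g \<inter> ball 0 \<epsilon> \<inter> upper_half_plane) \<longrightarrow>
       (\<exists>(M::nat) (C::real). M > 0 \<and> C > 0 \<and>
          (\<forall>m\<ge>M. \<exists>\<xi>\<in>lam m ` ball 0 \<epsilon>.
             monic_P m (lam_inv \<epsilon> m \<xi>) = 0 \<and>
             cmod (\<xi>s - \<xi>) \<le> C / real m powr (1 / 4))))"
proof -
  obtain \<epsilon>0 L where \<epsilon>0: "\<epsilon>0 > 0" and L: "L > 0"
    and chart: "\<And>\<epsilon>. 0 < \<epsilon> \<Longrightarrow> \<epsilon> < \<epsilon>0 \<Longrightarrow> local_chart \<epsilon>"
    and tau: "\<And>z. norm z < \<epsilon>0 \<Longrightarrow> norm (tau z - 1) \<le> L * norm z"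
    using local_chart_small by blast
  have zeros: "\<exists>(M::nat) (C::real). M > 0 \<and> C > 0 \<and>
          (\<forall>m\<ge>M. \<exists>\<xi>\<in>lam m ` ball 0 \<epsilon>.
             monic_P m (lam_inv \<epsilon> m \<xi>) = 0 \<and>
             cmod (\<xi>s - \<xi>) \<le> C / real m powr (1 / 4))"
    if \<epsilon>: "0 < \<epsilon>" "\<epsilon> < \<epsilon>0" and q: "q_ell \<xi>s = 0" for \<epsilon> \<xi>s
  proof -
    have tau': "norm (tau z - 1) \<le> L * norm z" if "norm z < \<epsilon>" for z
      using tau that \<epsilon> by simp
    obtain C M where C: "C > 0"
      and M: "\<And>m. m \<ge> M \<Longrightarrow> \<exists>z\<in>ball 0 \<epsilon>. jacobi_P m z = 0 \<and> norm (\<xi>s - lam m z) \<le> C / sqrt (2 * real m)"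
      using jacobi_zero_near_q_ell_zero[OF q L \<epsilon>(1) tau'] by blast
    have "\<exists>\<xi>\<in>lam m ` ball 0 \<epsilon>. monic_P m (lam_inv \<epsilon> m \<xi>) = 0 \<and> cmod (\<xi>s - \<xi>) \<le> C / real m powr (1 / 4)"
      if m: "m \<ge> max M 1" for m
    proof -
      obtain z where z: "z \<in> ball 0 \<epsilon>" "jacobi_P m z = 0" and close: "norm (\<xi>s - lam m z) \<le> C / sqrt (2 * real m)"
        using M[of m] m by auto
      have "inj_on (lam m) (ball 0 \<epsilon>)" using chart[OF \<epsilon>] m by (auto simp: local_chart_def)
      then have inv: "lam_inv \<epsilon> m (lam m z) = z" using z by (simp add: lam_inv_def)
      have "real m powr (1 / 4) \<le> real m powr (1 / 2)" using m by (intro powr_mono) auto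
      also have "\<dots> = sqrt (real m)" by (rule powr_half_sqrt) simp
      also have "\<dots> \<le> sqrt (2 * real m)" by simp
      finally have "C / sqrt (2 * real m) \<le> C / real m powr (1 / 4)"
        using C m by (intro divide_left_mono) auto
      with close have "cmod (\<xi>s - lam m z) \<le> C / real m powr (1 / 4)" by (rule order_trans)
      moreover have "monic_P m (lam_inv \<epsilon> m (lam m z)) = 0" by (simp add: inv monic_P_def z)
      ultimately show ?thesis using z(1) by blast
    qed
    then show ?thesis using C by (intro exI[of _ "max M 1"] exI[of _ C]) auto
  qed
  show ?thesis
    using \<epsilon>0 chart zeros by (intro exI[of _ \<epsilon>0]) blast
qed

end
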